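(* Let $Q$ be a quadrangulation of a polygon $M$ in the plane, and let $L:V(Q)\to\{1,2,3,4\}$ be a labelling such that no edge of $Q$ lying on the boundary $\partial Q$ has its two endpoints labelled $\{1,3\}$ or $\{2,4\}$. Then $Q$ contains at least $|\deg(L,\partial Q)|$ centrally labelled cells.
   Context: A quadrangulation of a polygon $M$ is a division of $M$ into quadrangles such that each side of a quadrangle either is entirely shared by two adjacent quadrangles or lies on the boundary of $M$; its cells are the quadrangles, their edges and their vertices, and $V(Q)$ is the vertex set. The boundary $\partial Q$ is a closed polygonal contour with vertices $v_1,\dots,v_m$ in counterclockwise order (indices cyclic, $v_{m+1}=v_1$). Let $p$ be the number of indices $k$ with $L(v_k)=1$, $L(v_{k+1})=2$, and $n$ the number of indices $k$ with $L(v_k)=2$, $L(v_{k+1})=1$; then $\deg(L,\partial Q):=p-n$. A cell of $Q$ is centrally labelled if it is either a quadrangle whose four vertices carry the four distinct labels $1,2,3,4$, or an edge whose two endpoints are labelled $\{1,3\}$ or $\{2,4\}$. *)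

theory Defs
  imports "HOL-Complex_Analysis.Complex_Analysis"
begin

text \<open>The plane is the complex plane.  A polygon is given by the cyclic list of its vertices.\<close>

fun polygonal_path :: "complex list \<Rightarrow> real \<Rightarrow> complex" where
  "polygonal_path [] = linepath 0 0"
| "polygonal_path [a] = linepath a a"
| "polygonal_path [a, b] = linepath a b"
| "polygonal_path (a # b # c # ps) = linepath a b +++ polygonal_path (b # c # ps)"

definition contour :: "complex list \<Rightarrow> real \<Rightarrow> complex" where
  "contour ps = polygonal_path (ps @ [hd ps])"

text \<open>Simplicity of the contour forces the vertices to be distinct.  Convexity is not required,
  and angles of 180 degrees are permitted: the boundary contour of a quadrangulation may have
  such vertices.\<close>

definition simple_polygon :: "complex list \<Rightarrow> bool" where
  "simple_polygon ps \<longleftrightarrow> 3 \<le> length ps \<and> simple_path (contour ps)"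

definition region :: "complex list \<Rightarrow> complex set" where
  "region ps = path_image (contour ps) \<union> inside (path_image (contour ps))"

definition polygon :: "complex set \<Rightarrow> bool" where
  "polygon M \<longleftrightarrow> (\<exists>ps. simple_polygon ps \<and> M = region ps)"

definition counterclockwise :: "complex list \<Rightarrow> bool" where
  "counterclockwise ps \<longleftrightarrow>
     (\<forall>z \<in> inside (path_image (contour ps)). winding_number (contour ps) z = 1)"

definition next_vertex :: "complex list \<Rightarrow> nat \<Rightarrow> complex" where
  "next_vertex ps k = ps ! (Suc k mod length ps)"

text \<open>A side is represented by its set of end points; as a set of points of the plane it is the
  convex hull of that set.\<close>

definition sides :: "complex list \<Rightarrow> complex set set" where
  "sides ps = {{ps ! k, next_vertex ps k} | k. k < length ps}"

text \<open>A quadrangle is listed in either orientation, starting at any vertex.  Since the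
  interiors of distinct members are disjoint, \<open>Q\<close> contains only one such list for each of its
  quadrangles.\<close>

definition quadrangulation :: "complex list set \<Rightarrow> complex set \<Rightarrow> bool" where
  "quadrangulation Q M \<longleftrightarrow>
     finite Q \<and>
     (\<forall>q \<in> Q. length q = 4 \<and> simple_polygon q) \<and>
     (\<Union>q \<in> Q. region q) = M \<and>
     (\<forall>q \<in> Q. \<forall>q' \<in> Q. q \<noteq> q' \<longrightarrow> interior (region q) \<inter> interior (region q') = {}) \<and>
     (\<forall>q \<in> Q. \<forall>e \<in> sides q.
        (\<exists>q' \<in> Q. q' \<noteq> q \<and> e \<in> sides q') \<or> convex hull e \<subseteq> frontier M)"

definition vertices :: "complex list set \<Rightarrow> complex set" where
  "vertices Q = (\<Union>q \<in> Q. set q)"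

definition edges :: "complex list set \<Rightarrow> complex set set" where
  "edges Q = (\<Union>q \<in> Q. sides q)"

text \<open>The contour \<open>\<partial>Q\<close>: all vertices of \<open>Q\<close> on the boundary of \<open>M\<close>, including those that are not
  corners of \<open>M\<close>, in counterclockwise order.  The list is unique up to rotation.\<close>

definition boundary_contour :: "complex list set \<Rightarrow> complex set \<Rightarrow> complex list \<Rightarrow> bool" where
  "boundary_contour Q M vs \<longleftrightarrow>
     simple_polygon vs \<and> counterclockwise vs \<and>
     path_image (contour vs) = frontier M \<and>
     set vs = vertices Q \<inter> frontier M"

definition deg :: "(complex \<Rightarrow> nat) \<Rightarrow> complex list \<Rightarrow> int" where
  "deg L vs =
     int (card {k. k < length vs \<and> L (vs ! k) = 1 \<and> L (next_vertex vs k) = 2}) -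
     int (card {k. k < length vs \<and> L (vs ! k) = 2 \<and> L (next_vertex vs k) = 1})"

datatype cell = Face "complex list" | Edge "complex set" | Vertex complex

definition cells :: "complex list set \<Rightarrow> cell set" where
  "cells Q = Face ` Q \<union> Edge ` edges Q \<union> Vertex ` vertices Q"

definition central_edge :: "(complex \<Rightarrow> nat) \<Rightarrow> complex set \<Rightarrow> bool" where
  "central_edge L e \<longleftrightarrow> L ` e = {1, 3} \<or> L ` e = {2, 4}"

fun centrally_labelled :: "(complex \<Rightarrow> nat) \<Rightarrow> cell \<Rightarrow> bool" where
  "centrally_labelled L (Face q) \<longleftrightarrow> L ` set q = {1, 2, 3, 4}"
| "centrally_labelled L (Edge e) \<longleftrightarrow> central_edge L e"
| "centrally_labelled L (Vertex v) \<longleftrightarrow> False"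

end

theory Submission
  imports Defs
begin

text \<open>Assign to an oriented edge twice the signed number of steps from label 1 to label 2 that it
  makes, a central edge making half a step; this is antisymmetric in the end points.  The sum around
  a quadrangle is bounded by 2 if it is centrally labelled, plus 1 for each of its central sides.
  Every edge is a side of at most two quadrangles, so it suffices that the sums around the
  counterclockwise quadrangles add up to the sum around \<open>\<partial>Q\<close>, which is twice the degree.

  For this cancellation consider the chain formed by the counterclockwise quadrangles minus \<open>\<partial>Q\<close>.
  Its winding number vanishes at all points off the edges, whereas across an edge it jumps by the
  net multiplicity of that edge.  The jump is seen at a generic point of the edge, which requires
  that no vertex lies in the interior of an edge; this follows from the Jordan curve theorem, as
  along a straight piece of its contour a polygon lies on exactly one side.\<close>

section \<open>Polygonal contours\<close>

text \<open>\<open>quadrangulation\<close> says of a side only that it recurs in another member or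
  lies on the frontier. It does not say that neighbours run through a common side in opposite
  directions, nor that a side of \<open>vs\<close> is an edge of \<open>Q\<close>. Moreover
  quadrangles may be non-convex and listed in either direction, so there is no combinatorial model
  of the plane to argue in. Winding numbers supply what is missing: direction becomes a sign,
  adjacency becomes disjointness of small half discs beside an edge, and the coefficients of a chain
  can be read off from its winding number. As the label weight is antisymmetric, the coefficients
  need not vanish; it is enough that they agree on the two orientations of each edge, and this is
  just what the jump across an edge detects. Doubling the weights keeps the half steps
  integral.\<close>

fun polyline :: "complex list \<Rightarrow> complex set" where
  "polyline (a # b # ps) = closed_segment a b \<union> polyline (b # ps)"
| "polyline ps = set ps"

lemma pathstart_polygonal_path [simp]: "ps \<noteq> [] \<Longrightarrow> pathstart (polygonal_path ps) = hd ps"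
  by (induction ps rule: polygonal_path.induct) auto

lemma pathfinish_polygonal_path [simp]: "ps \<noteq> [] \<Longrightarrow> pathfinish (polygonal_path ps) = last ps"
  by (induction ps rule: polygonal_path.induct) auto

lemma path_polygonal_path [simp]: "path (polygonal_path ps)"
proof -
  have "path (\<lambda>_. a)" for a :: complex by (simp add: path_def)
  then show ?thesis by (induction ps rule: polygonal_path.induct) auto
qed

lemma path_image_polygonal_path:
  "ps \<noteq> [] \<Longrightarrow> path_image (polygonal_path ps) = polyline ps"
  by (induction ps rule: polygonal_path.induct) (auto simp: path_image_join)

lemma set_subset_polyline: "set ps \<subseteq> polyline ps"
  by (induction ps rule: polyline.induct) auto

lemma compact_polyline: "compact (polyline ps)"
  by (induction ps rule: polyline.induct) (auto intro: compact_Un finite_imp_compact)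

lemma closed_polyline: "closed (polyline ps)"
  by (simp add: compact_imp_closed compact_polyline)

lemma polyline_nth:
  assumes "Suc i < length ps"
  shows "closed_segment (ps ! i) (ps ! Suc i) \<subseteq> polyline ps"
  using assms
proof (induction ps arbitrary: i rule: polyline.induct)
  case (1 a b ps)
  then show ?case by (cases i) auto
qed auto

lemma arc_polygonal_path_Cons:
  assumes "arc (polygonal_path (a # b # ps))" "ps \<noteq> []"
  shows "a \<noteq> b" "arc (polygonal_path (b # ps))"
    "closed_segment a b \<inter> polyline (b # ps) = {b}"
proof -
  obtain c qs where ps: "ps = c # qs" using assms(2) by (cases ps) auto
  have "arc (linepath a b +++ polygonal_path (b # ps))" using assms(1) ps by simp
  then have *: "arc (linepath a b)" "arc (polygonal_path (b # ps))"
    "closed_segment a b \<inter> polyline (b # ps) \<subseteq> {b}"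
    by (subst (asm) arc_join_eq; simp add: path_image_polygonal_path)+
  show "arc (polygonal_path (b # ps))" by fact
  show "a \<noteq> b" using arc_distinct_ends[OF *(1)] by simp
  have "b \<in> polyline (b # ps)" using set_subset_polyline[of "b # ps"] by simp
  then show "closed_segment a b \<inter> polyline (b # ps) = {b}" using *(3) by auto
qed

lemma distinct_if_arc_polygonal_path:
  assumes "arc (polygonal_path ps)" "2 \<le> length ps"
  shows "distinct ps"
  using assms
proof (induction ps rule: polygonal_path.induct)
  case (3 a b)
  then show ?case using arc_distinct_ends[OF 3(1)] by simp
next
  case (4 a b c ps)
  note A = arc_polygonal_path_Cons[OF 4(2)]
  have "distinct (b # c # ps)" using 4 A by simp
  moreover have "a \<notin> set (b # c # ps)"
    using A set_subset_polyline[of "b # c # ps"] by auto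
  ultimately show ?case by simp
qed auto

text \<open>An arc is injective, so it cannot pass a vertex again inside a segment. In the
  induction, the rest of the line meets the first segment only in \<open>b\<close>, and
  \<open>a\<close> is off the rest.\<close>

lemma vertex_notin_open_segment_if_arc:
  assumes "arc (polygonal_path ps)" "w \<in> set ps" "Suc i < length ps"
  shows "w \<notin> open_segment (ps ! i) (ps ! Suc i)"
  using assms
proof (induction ps arbitrary: i rule: polygonal_path.induct)
  case (3 a b)
  then show ?case by (auto simp: open_segment_def)
next
  case (4 a b c ps)
  note A = arc_polygonal_path_Cons[OF 4(2), simplified]
  show ?case
  proof (cases i)
    case 0
    then show ?thesis
      using A 4(3) set_subset_polyline[of "b # c # ps"] by (auto simp: open_segment_def)
  next
    case (Suc j)
    have j: "Suc j < length (b # c # ps)" using 4(4) Suc by simp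
    show ?thesis
    proof (cases "w = a")
      case True
      have "open_segment ((b # c # ps) ! j) ((b # c # ps) ! Suc j) \<subseteq> polyline (b # c # ps)"
        using polyline_nth[OF j] segment_open_subset_closed by blast
      moreover have "a \<notin> polyline (b # c # ps)" using A by auto
      ultimately show ?thesis using Suc True by auto
    next
      case False
      then show ?thesis using 4(1)[of j] 4(3) A j Suc by auto
    qed
  qed
qed auto

section \<open>Shape of an arc near one of its points\<close>

lemma ball_disjoint_closed:
  fixes S :: "complex set"
  assumes "closed S" "v \<notin> S"
  obtains e where "e > 0" "ball v e \<inter> S = {}"
proof -
  obtain e where "e > 0" "ball v e \<subseteq> - S"
    using assms open_contains_ball[of "- S"] by auto
  then show thesis using that[of e] by auto
qed

text \<open>The clause \<open>c = d\<close> at the two ends strengthens the induction: at the joint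
  \<open>b\<close> the tail supplies one arm and the first segment the other. It serves again when
  an arc is closed up to a polygon.\<close>

lemma arc_locally_two_segments:
  assumes "arc (polygonal_path ps)" "2 \<le> length ps" "v \<in> polyline ps"
  shows "\<exists>e>0. \<exists>c d. ball v e \<inter> polyline ps \<subseteq> closed_segment v c \<union> closed_segment v d \<and>
    (v = hd ps \<or> v = last ps \<longrightarrow> c = d)"
  using assms
proof (induction ps rule: polygonal_path.induct)
  case (3 a b)
  have v: "v \<in> closed_segment a b" using 3(3) by auto
  have I: "ball v 1 \<inter> polyline [a, b] \<subseteq> closed_segment a b" by auto
  have split: "closed_segment a b \<subseteq> closed_segment v a \<union> closed_segment v b"
    using v Un_closed_segment[of v a b] by (auto simp: closed_segment_commute)
  consider "v = a" | "v = b" | "v \<noteq> a" "v \<noteq> b" by blast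
  then show ?case
  proof cases
    case 1
    then show ?thesis using I by (intro exI[of _ 1] conjI exI[of _ b]) auto
  next
    case 2
    then show ?thesis using I
      by (intro exI[of _ 1] conjI exI[of _ a]) (auto simp: closed_segment_commute)
  next
    case 3
    then show ?thesis using I split
      by (intro exI[of _ 1] conjI exI[of _ a] exI[of _ b]) auto
  qed
next
  case (4 a b c ps)
  note A = arc_polygonal_path_Cons[OF 4(2), simplified]
  let ?P = "polyline (b # c # ps)"
  have split: "closed_segment a b \<subseteq> closed_segment v a \<union> closed_segment v b" if "v \<in> closed_segment a b"
    using that Un_closed_segment[of v a b] by (auto simp: closed_segment_commute)
  have last: "last (b # c # ps) \<in> ?P" using set_subset_polyline[of "b # c # ps"] last_in_set[of "b # c # ps"] by blast
  consider "v \<notin> closed_segment a b" | "v \<notin> ?P" | "v = b" using A 4(4) by auto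
  then show ?case
  proof cases
    case 1
    then have "v \<in> ?P" using 4(4) by simp
    then obtain e x y where e: "e > 0" "ball v e \<inter> ?P \<subseteq> closed_segment v x \<union> closed_segment v y"
      "v = b \<or> v = last (b # c # ps) \<longrightarrow> x = y" using 4(1) A by auto
    obtain e' where e': "e' > 0" "ball v e' \<inter> closed_segment a b = {}"
      using ball_disjoint_closed[OF closed_segment 1] by blast
    have "ball v (min e e') \<inter> polyline (a # b # c # ps) \<subseteq> closed_segment v x \<union> closed_segment v y"
      using e(2) e'(2) by auto
    moreover have "v \<noteq> a" using 1 by auto
    ultimately show ?thesis using e e'
      by (intro exI[of _ "min e e'"] conjI exI[of _ x] exI[of _ y]) auto
  next
    case 2
    then have v: "v \<in> closed_segment a b" using 4(4) by simp
    obtain e' where e': "e' > 0" "ball v e' \<inter> ?P = {}"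
      using ball_disjoint_closed[OF closed_polyline 2] by blast
    have I: "ball v e' \<inter> polyline (a # b # c # ps) \<subseteq> closed_segment a b" using e' by auto
    have "v \<noteq> last (a # b # c # ps)" using 2 last by auto
    show ?thesis
    proof (cases "v = a")
      case True
      then show ?thesis using e' I by (intro exI[of _ e'] conjI exI[of _ b]) auto
    next
      case False
      then show ?thesis using e' I \<open>v \<noteq> last _\<close> split[OF v]
        by (intro exI[of _ e'] conjI exI[of _ a] exI[of _ b]) auto
    qed
  next
    case 3
    have "v \<in> ?P" using 3 set_subset_polyline[of "b # c # ps"] by auto
    then obtain e x where e: "e > 0" "ball v e \<inter> ?P \<subseteq> closed_segment v x"
      using 4(1) A 3 by auto
    have "distinct (b # c # ps)" using distinct_if_arc_polygonal_path[of "b # c # ps"] A by simp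
    then have "v \<noteq> last (a # b # c # ps)" using 3 by (metis distinct.simps(2) last_ConsR last_in_set list.simps(3))
    then show ?thesis using e A 3
      by (intro exI[of _ e] conjI exI[of _ a] exI[of _ x]) (auto simp: closed_segment_commute)
  qed
qed auto

lemma polyline_conv_nth:
  assumes "2 \<le> length ps"
  shows "polyline ps = (\<Union>i<length ps - 1. closed_segment (ps ! i) (ps ! Suc i))"
  using assms
proof (induction ps rule: polygonal_path.induct)
  case (4 a b c ps)
  have "{..<length (a # b # c # ps) - 1} = insert 0 (Suc ` {..<length (b # c # ps) - 1})"
    using lessThan_Suc_eq_insert_0[of "length (b # c # ps) - 1"] by simp
  then have "(\<Union>i<length (a # b # c # ps) - 1. closed_segment ((a # b # c # ps) ! i) ((a # b # c # ps) ! Suc i))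
    = closed_segment a b \<union> (\<Union>i<length (b # c # ps) - 1. closed_segment ((b # c # ps) ! i) ((b # c # ps) ! Suc i))"
    by (simp only: UN_insert) (simp del: lessThan_Suc)
  then show ?case using 4 by simp
qed auto

lemma winding_number_polygonal_path:
  assumes "2 \<le> length ps" "z \<notin> polyline ps"
  shows "winding_number (polygonal_path ps) z =
    (\<Sum>i<length ps - 1. winding_number (linepath (ps ! i) (ps ! Suc i)) z)"
  using assms
proof (induction ps rule: polygonal_path.induct)
  case (4 a b c ps)
  have "winding_number (polygonal_path (a # b # c # ps)) z =
     winding_number (linepath a b) z + winding_number (polygonal_path (b # c # ps)) z"
    using 4(3) path_image_polygonal_path[of "b # c # ps"]
    by (simp add: winding_number_join)
  then show ?case using 4 by (simp add: sum.lessThan_Suc_shift del: sum.lessThan_Suc)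
qed auto

lemma append_hd_nth:
  assumes "k < length ps"
  shows "(ps @ [hd ps]) ! k = ps ! k" "(ps @ [hd ps]) ! Suc k = next_vertex ps k"
proof -
  show "(ps @ [hd ps]) ! k = ps ! k" using assms by (simp add: nth_append)
  show "(ps @ [hd ps]) ! Suc k = next_vertex ps k"
  proof (cases "Suc k = length ps")
    case True
    then show ?thesis using assms hd_conv_nth[of ps] by (force simp: nth_append next_vertex_def)
  next
    case False
    then show ?thesis using assms by (simp add: nth_append next_vertex_def)
  qed
qed

section \<open>Closed contours of simple polygons\<close>

lemma path_contour [simp]: "path (contour ps)"
  and loop_contour: "ps \<noteq> [] \<Longrightarrow> pathfinish (contour ps) = pathstart (contour ps)"
  by (auto simp: contour_def)

lemma path_image_contour:
  assumes "ps \<noteq> []"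
  shows "path_image (contour ps) = (\<Union>k<length ps. closed_segment (ps ! k) (next_vertex ps k))"
proof -
  have "2 \<le> length (ps @ [hd ps])" using assms by (cases ps) auto
  from polyline_conv_nth[OF this] show ?thesis
    by (simp add: contour_def path_image_polygonal_path append_hd_nth)
qed

lemma winding_number_contour:
  assumes "ps \<noteq> []" "z \<notin> path_image (contour ps)"
  shows "winding_number (contour ps) z =
    (\<Sum>k<length ps. winding_number (linepath (ps ! k) (next_vertex ps k)) z)"
proof -
  have "2 \<le> length (ps @ [hd ps])" using assms by (cases ps) auto
  from winding_number_polygonal_path[OF this] assms show ?thesis
    by (simp add: contour_def path_image_polygonal_path append_hd_nth)
qed

text \<open>Cutting the contour into its first side and the complementary arc makes the results on
  arcs available for polygons.\<close>

lemma simple_polygon_Cons: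
  assumes "simple_polygon ps"
  obtains p q qs where "ps = p # q # qs" "qs \<noteq> []" "p \<noteq> q" "arc (polygonal_path (q # qs @ [p]))"
    "closed_segment p q \<inter> polyline (q # qs @ [p]) = {p, q}"
    "path_image (contour ps) = closed_segment p q \<union> polyline (q # qs @ [p])"
proof -
  have "3 \<le> length ps" using assms by (simp add: simple_polygon_def)
  then obtain p q r rs where ps: "ps = p # q # r # rs"
    by (metis Suc_le_length_iff numeral_3_eq_3)
  let ?g = "polygonal_path (q # r # rs @ [p])"
  have "simple_path (linepath p q +++ ?g)"
    using assms ps by (simp add: simple_polygon_def contour_def)
  then have *: "arc (linepath p q)" "arc ?g"
    "closed_segment p q \<inter> polyline (q # r # rs @ [p]) \<subseteq> {p, q}"
    by (subst (asm) simple_path_join_loop_eq; simp add: path_image_polygonal_path)+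
  moreover have "{p, q} \<subseteq> polyline (q # r # rs @ [p])"
    using set_subset_polyline[of "q # r # rs @ [p]"] by auto
  moreover have "p \<noteq> q" using arc_distinct_ends[OF *(1)] by simp
  moreover have "path_image (contour ps) = closed_segment p q \<union> polyline (q # r # rs @ [p])"
    by (simp add: ps contour_def path_image_join path_image_polygonal_path)
  ultimately show thesis using that[of p q "r # rs"] ps by auto
qed

lemma simple_polygon_distinct:
  assumes "simple_polygon ps"
  shows "distinct ps"
proof -
  obtain p q qs where *: "ps = p # q # qs" "arc (polygonal_path (q # qs @ [p]))"
    using simple_polygon_Cons[OF assms] by metis
  have "distinct (q # qs @ [p])" using distinct_if_arc_polygonal_path[OF *(2)] by simp
  then show ?thesis using * by auto
qed

lemma simple_polygon_vertex_notin_open_segment: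
  assumes "simple_polygon ps" "w \<in> set ps" "k < length ps"
  shows "w \<notin> open_segment (ps ! k) (next_vertex ps k)"
proof -
  obtain p q qs where *: "ps = p # q # qs" "p \<noteq> q" "arc (polygonal_path (q # qs @ [p]))"
    "closed_segment p q \<inter> polyline (q # qs @ [p]) = {p, q}"
    using simple_polygon_Cons[OF assms(1)] by metis
  let ?ps = "q # qs @ [p]"
  have w: "w \<in> set ?ps" using assms(2) * by auto
  show ?thesis
  proof (cases k)
    case 0
    then have "open_segment (ps ! k) (next_vertex ps k) = open_segment p q"
      using * by (auto simp: next_vertex_def)
    then show ?thesis using w *(4) set_subset_polyline[of ?ps] by (auto simp: open_segment_def)
  next
    case (Suc j)
    then have j: "Suc j < length ?ps" using assms(3) * by simp
    have "?ps ! j = ps ! k" "?ps ! Suc j = next_vertex ps k"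
      using append_hd_nth[OF assms(3)] * Suc by auto
    then show ?thesis using vertex_notin_open_segment_if_arc[OF *(3) w j] by simp
  qed
qed

lemma simple_polygon_locally_two_segments:
  assumes "simple_polygon ps"
  shows "\<exists>e>0. \<exists>c d. ball v e \<inter> path_image (contour ps) \<subseteq> closed_segment v c \<union> closed_segment v d"
proof -
  obtain p q qs where *: "arc (polygonal_path (q # qs @ [p]))"
    "closed_segment p q \<inter> polyline (q # qs @ [p]) = {p, q}"
    "path_image (contour ps) = closed_segment p q \<union> polyline (q # qs @ [p])"
    using simple_polygon_Cons[OF assms] by metis
  let ?P = "polyline (q # qs @ [p])"
  have arms: "v \<in> ?P \<Longrightarrow> \<exists>e>0. \<exists>c d. ball v e \<inter> ?P \<subseteq> closed_segment v c \<union> closed_segment v d \<and>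
    (v = q \<or> v = p \<longrightarrow> c = d)"
    using arc_locally_two_segments[OF *(1)] by simp
  consider "v \<in> closed_segment p q" "v \<notin> ?P" | "v \<notin> closed_segment p q" "v \<notin> ?P"
    | "v \<notin> closed_segment p q" "v \<in> ?P" | "v \<in> ?P" "v = p \<or> v = q" using *(2) by blast
  then show ?thesis
  proof cases
    case 1
    obtain e where e: "e > 0" "ball v e \<inter> ?P = {}"
      using ball_disjoint_closed[OF closed_polyline 1(2)] by blast
    moreover have "closed_segment p q \<subseteq> closed_segment v p \<union> closed_segment v q"
      using Un_closed_segment[OF 1(1)] by (simp add: closed_segment_commute)
    ultimately show ?thesis using *(3) by blast
  next
    case 2
    then obtain e where "e > 0" "ball v e \<inter> (closed_segment p q \<union> ?P) = {}"
      using ball_disjoint_closed[OF closed_Un[OF closed_segment closed_polyline], of v p q "q # qs @ [p]"]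
      by blast
    then show ?thesis using *(3) by auto
  next
    case 3
    obtain e where e: "e > 0" "ball v e \<inter> closed_segment p q = {}"
      using ball_disjoint_closed[OF closed_segment 3(1)] by blast
    obtain e' c d where "e' > 0" "ball v e' \<inter> ?P \<subseteq> closed_segment v c \<union> closed_segment v d"
      using arms[OF 3(2)] by blast
    with e *(3) have "min e e' > 0"
      "ball v (min e e') \<inter> path_image (contour ps) \<subseteq> closed_segment v c \<union> closed_segment v d"
      by auto
    then show ?thesis by blast
  next
    \<comment> \<open>At its ends \<open>p\<close> and \<open>q\<close> the arc has a single arm, so
      the side from \<open>p\<close> to \<open>q\<close> can be the second one.\<close>
    case 4
    obtain e c where "e > 0" "ball v e \<inter> ?P \<subseteq> closed_segment v c"
      using arms[OF 4(1)] 4(2) by auto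
    moreover have "closed_segment p q \<subseteq> closed_segment v p \<union> closed_segment v q"
      using 4(2) by (auto simp: closed_segment_commute)
    moreover have "closed_segment v p = {p} \<or> closed_segment v q = {q}" using 4(2) by auto
    ultimately have "ball v e \<inter> path_image (contour ps) \<subseteq> closed_segment v c \<union> closed_segment p q" "e > 0"
      "closed_segment p q = closed_segment v p \<or> closed_segment p q = closed_segment v q"
      using *(3) 4(2) by (auto simp: closed_segment_commute)
    then show ?thesis by metis
  qed
qed

section \<open>The two sides of an edge\<close>

text \<open>Both points lie on one ray from \<open>x\<close>, along which the distance from
  \<open>x\<close> is proportional to the parameter.\<close>

lemma closed_segment_from_endpoint:
  fixes x c :: complex
  assumes "y \<in> closed_segment x c" "w \<in> closed_segment x c" "dist x y \<le> dist x w"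
  shows "y \<in> closed_segment x w"
proof -
  obtain s r where s: "0 \<le> s" "y = x + s *\<^sub>R (c - x)" and r: "0 \<le> r" "w = x + r *\<^sub>R (c - x)"
    using assms(1,2) by (auto simp: in_segment algebra_simps)
  show ?thesis
  proof (cases "w = x")
    case True
    then show ?thesis using assms(3) by simp
  next
    case False
    then have "c \<noteq> x" "r > 0" using r by auto
    then have "s \<le> r" using assms(3) s r by (simp add: dist_norm)
    have "y = x + (s / r) *\<^sub>R (w - x)" using s r \<open>r > 0\<close> by simp
    then have "y = (1 - s / r) *\<^sub>R x + (s / r) *\<^sub>R w" by (simp add: algebra_simps)
    moreover have "0 \<le> s / r" "s / r \<le> 1" using s r \<open>r > 0\<close> \<open>s \<le> r\<close> by auto
    ultimately have "y = (1 - s / r) *\<^sub>R x + (s / r) *\<^sub>R w" "0 \<le> s / r" "s / r \<le> 1" by blast+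
    then show ?thesis unfolding in_segment by blast
  qed
qed

text \<open>The straight piece leaves \<open>x\<close> in two opposite directions and so uses up
  both arms of the contour at \<open>x\<close>. It need not be a side of \<open>ps\<close>: later it
  is a side of a quadrangle that lies on the contour of \<open>vs\<close>.\<close>

lemma simple_polygon_locally_straight:
  assumes "simple_polygon ps" "closed_segment a b \<subseteq> path_image (contour ps)"
    and x: "x \<in> open_segment a b"
  obtains e where "e > 0" "ball x e \<inter> path_image (contour ps) \<subseteq> closed_segment a b"
proof -
  obtain e c d where e: "e > 0"
    "ball x e \<inter> path_image (contour ps) \<subseteq> closed_segment x c \<union> closed_segment x d"
    using simple_polygon_locally_two_segments[OF assms(1)] by blast
  have ab: "a \<noteq> b" "x \<noteq> a" "x \<noteq> b" "x \<in> closed_segment a b"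
    using x by (auto simp: open_segment_def)
  \<comment> \<open>Shrinking towards \<open>x\<close> by \<open>t\<close> keeps \<open>a'\<close>
    and \<open>b'\<close> on the segment because \<open>t \<le> 1\<close>, and puts them into the
    ball because \<open>t\<close> times the sum of both distances is below \<open>e\<close>.\<close>
  define t where "t = min 1 (e / (2 * (dist x a + dist x b)))"
  have pos: "dist x a + dist x b > 0" using ab by (simp add: add_pos_pos)
  then have t: "0 < t" "t \<le> 1" using e by (auto simp: t_def)
  have "t * (dist x a + dist x b) \<le> e / (2 * (dist x a + dist x b)) * (dist x a + dist x b)"
    using pos by (intro mult_right_mono) (auto simp: t_def)
  also have "\<dots> = e / 2" using pos by (subst nonzero_mult_divide_mult_cancel_right2[symmetric, of 2]) (auto simp: field_simps)
  also have "\<dots> < e" using e by simp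
  finally have te: "t * (dist x a + dist x b) < e" .
  define a' b' where "a' = x + t *\<^sub>R (a - x)" and "b' = x + t *\<^sub>R (b - x)"
  have "dist x a' = t * dist x a" "dist x b' = t * dist x b"
    using t by (auto simp: a'_def b'_def dist_norm norm_minus_commute)
  moreover have "t * dist x a < e" "t * dist x b < e"
    using te t by (smt (verit) distrib_left mult_nonneg_nonneg zero_le_dist)+
  ultimately have inb: "a' \<in> ball x e" "b' \<in> ball x e" by auto
  have "a' \<in> closed_segment x a" "b' \<in> closed_segment x b"
    using t unfolding in_segment by (auto intro!: exI[of _ t] simp: a'_def b'_def algebra_simps)
  then have inc: "a' \<in> closed_segment a b" "b' \<in> closed_segment a b"
    using ab(4) by (meson ends_in_segment subsetD subset_closed_segment)+
  have ne: "a' \<noteq> x" "b' \<noteq> x" "a' \<noteq> b'" using t ab by (auto simp: a'_def b'_def)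
  have "x \<in> open_segment a' b'"
  proof -
    obtain u where u: "0 < u" "u < 1" "x = (1 - u) *\<^sub>R a + u *\<^sub>R b" using x by (auto simp: in_segment)
    have "(1 - u) *\<^sub>R a' + u *\<^sub>R b' = x + t *\<^sub>R ((1 - u) *\<^sub>R a + u *\<^sub>R b - x)"
      by (simp add: a'_def b'_def algebra_simps)
    then show ?thesis using u ne by (auto simp: in_segment)
  qed
  \<comment> \<open>An end point of a segment is extreme, so \<open>x\<close> cannot lie strictly
    between two points of one arm: \<open>a'\<close> and \<open>b'\<close> are on different
    arms.\<close>
  then have no: "\<not> (a' \<in> closed_segment x w \<and> b' \<in> closed_segment x w)" for w
    using extreme_point_of_segment[of x x w] by (auto simp: extreme_point_of_def)
  have "a' \<in> closed_segment x c \<union> closed_segment x d" "b' \<in> closed_segment x c \<union> closed_segment x d"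
    using e inb inc assms(2) by blast+
  then have *: "a' \<in> closed_segment x c \<and> b' \<in> closed_segment x d \<or>
      b' \<in> closed_segment x c \<and> a' \<in> closed_segment x d"
    using no by blast
  define r where "r = min e (min (dist x a') (dist x b'))"
  have "r > 0" using e ne by (simp add: r_def)
  moreover have "y \<in> closed_segment a b" if y: "y \<in> ball x r" "y \<in> path_image (contour ps)" for y
  proof -
    have "dist x y \<le> dist x a'" "dist x y \<le> dist x b'" "y \<in> ball x e" using y by (auto simp: r_def)
    moreover have "y \<in> closed_segment x c \<union> closed_segment x d" using e y calculation by blast
    ultimately have "y \<in> closed_segment x a' \<or> y \<in> closed_segment x b'"
      using * closed_segment_from_endpoint by blast
    then show ?thesis using inc ab(4) by (meson subsetD subset_closed_segment)
  qed
  ultimately show thesis using that by blast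
qed

section \<open>Half discs on the two sides of an edge\<close>

definition half_disc :: "complex \<Rightarrow> complex \<Rightarrow> real \<Rightarrow> complex set" where
  "half_disc x v e = ball x e \<inter> {z. 0 < v \<bullet> (z - x)}"

lemma half_disc_mono: "e \<le> e' \<Longrightarrow> half_disc x v e \<subseteq> half_disc x v e'"
  by (auto simp: half_disc_def)

lemma half_disc_nonempty:
  assumes "e > 0" "v \<noteq> 0"
  shows "half_disc x v e \<noteq> {}"
proof -
  define z where "z = x + (e / (2 * norm v)) *\<^sub>R v"
  have "dist x z = e / 2" using assms by (simp add: z_def dist_norm)
  moreover have "0 < v \<bullet> (z - x)" using assms by (simp add: z_def inner_gt_zero_iff)
  ultimately have "z \<in> half_disc x v e" using assms by (simp add: half_disc_def)
  then show ?thesis by blast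
qed

lemma connected_half_disc: "connected (half_disc x v e)"
proof -
  have "half_disc x v e = ball x e \<inter> {z. v \<bullet> z > v \<bullet> x}"
    by (auto simp: half_disc_def inner_diff_right)
  then have "convex (half_disc x v e)"
    by (simp add: convex_Int convex_halfspace_gt)
  then show ?thesis by (rule convex_connected)
qed

text \<open>An open set missing both half discs meets the smaller ball only in the line through
  \<open>x\<close> orthogonal to \<open>v\<close>, and a line has empty interior.\<close>

lemma notin_closure_if_disjoint_half_discs:
  assumes "open U" "v \<noteq> 0" "e > 0" "e' > 0"
    and "half_disc x v e \<inter> U = {}" "half_disc x (- v) e' \<inter> U = {}"
  shows "x \<notin> closure U"
proof -
  have "ball x (min e e') \<inter> U \<subseteq> {z. v \<bullet> z = v \<bullet> x}"
    using assms(5,6) by (force simp: half_disc_def inner_diff_right)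
  then have "ball x (min e e') \<inter> U \<subseteq> interior {z. v \<bullet> z = v \<bullet> x}"
    using assms(1) by (intro interior_maximal) auto
  then have "ball x (min e e') \<inter> U = {}" using assms(2) by simp
  then have "ball x (min e e') \<inter> closure U = {}" by (simp add: open_Int_closure_eq_empty)
  then show ?thesis using assms(3,4) by (metis centre_in_ball disjoint_iff min_less_iff_conj)
qed

abbreviation inner_region :: "complex list \<Rightarrow> complex set" where
  "inner_region ps \<equiv> inside (path_image (contour ps))"

abbreviation outer_region :: "complex list \<Rightarrow> complex set" where
  "outer_region ps \<equiv> outside (path_image (contour ps))"

lemma
  assumes "simple_polygon ps"
  shows open_inner_region: "open (inner_region ps)"
    and open_outer_region: "open (outer_region ps)"
    and frontier_inner_region: "frontier (inner_region ps) = path_image (contour ps)"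
    and frontier_outer_region: "frontier (outer_region ps) = path_image (contour ps)"
proof -
  have "ps \<noteq> []" "simple_path (contour ps)" using assms by (auto simp: simple_polygon_def)
  note Jordan_inside_outside[OF this(2) loop_contour[OF this(1)]]
  then show "open (inner_region ps)" "open (outer_region ps)"
    "frontier (inner_region ps) = path_image (contour ps)"
    "frontier (outer_region ps) = path_image (contour ps)" by auto
qed

lemma outer_region_eq: "outer_region ps = - region ps"
  unfolding region_def by (metis union_with_inside double_compl)

lemma closure_inner_region:
  "simple_polygon ps \<Longrightarrow> closure (inner_region ps) = region ps"
  using closure_Un_frontier[of "inner_region ps"] by (simp add: frontier_inner_region region_def Un_commute)

lemma frontier_region: "simple_polygon ps \<Longrightarrow> frontier (region ps) = path_image (contour ps)"
  using frontier_outer_region outer_region_eq by (metis frontier_complement)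

lemma inner_region_subset: "simple_polygon ps \<Longrightarrow> inner_region ps \<subseteq> interior (region ps)"
  by (intro interior_maximal open_inner_region) (auto simp: region_def)

text \<open>Near \<open>x\<close> the contour stays on the line through \<open>a\<close> and
  \<open>b\<close>, so a half disc along a normal of it avoids the contour and, being connected, is
  entirely inside or entirely outside. By the Jordan curve theorem \<open>x\<close> is a limit of
  the inside and of the outside, so the two half discs are of different kinds.\<close>

lemma half_discs:
  assumes ps: "simple_polygon ps" and ab: "closed_segment a b \<subseteq> path_image (contour ps)"
    and x: "x \<in> open_segment a b"
  obtains v e where "v = \<i> * (b - a) \<or> v = - (\<i> * (b - a))" "e > 0"
    "half_disc x v e \<subseteq> inner_region ps" "half_disc x (- v) e \<subseteq> outer_region ps"
proof -
  obtain e where e: "e > 0" "ball x e \<inter> path_image (contour ps) \<subseteq> closed_segment a b"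
    using simple_polygon_locally_straight[OF assms] by blast
  define w where "w = \<i> * (b - a)"
  have xs: "x \<in> closed_segment a b" and "a \<noteq> b" using x by (auto simp: open_segment_def)
  have "w \<noteq> 0" using \<open>a \<noteq> b\<close> by (simp add: w_def)
  have perp: "w \<bullet> (z - x) = 0" if z: "z \<in> closed_segment a b" for z
  proof -
    obtain s t where st: "z = (1 - s) *\<^sub>R a + s *\<^sub>R b" "x = (1 - t) *\<^sub>R a + t *\<^sub>R b"
      using z xs unfolding in_segment by metis
    have "z - x = (s - t) *\<^sub>R (b - a)" unfolding st by (simp add: algebra_simps)
    moreover have "(\<i> * u) \<bullet> u = 0" for u :: complex by (simp add: inner_complex_def)
    ultimately show ?thesis by (simp add: w_def)
  qed
  have disj: "half_disc x v e \<inter> path_image (contour ps) = {}" if "v = w \<or> v = - w" for v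
  proof -
    have "v \<bullet> (z - x) = 0" if "z \<in> ball x e" "z \<in> path_image (contour ps)" for z
      using perp[of z] e(2) that \<open>v = w \<or> v = - w\<close> by auto
    then show ?thesis unfolding half_disc_def by fastforce
  qed
  have alt: "half_disc x v e \<subseteq> inner_region ps \<and> half_disc x v e \<inter> outer_region ps = {} \<or>
     half_disc x v e \<subseteq> outer_region ps \<and> half_disc x v e \<inter> inner_region ps = {}"
    if "v = w \<or> v = - w" for v
  proof -
    have sub: "half_disc x v e \<subseteq> inner_region ps \<union> outer_region ps"
      using disj[OF that] by auto
    have dis: "inner_region ps \<inter> outer_region ps = {}" by simp
    then have "inner_region ps \<inter> half_disc x v e = {} \<or> outer_region ps \<inter> half_disc x v e = {}"
      using connectedD[OF connected_half_disc[of x v e] open_inner_region[OF ps] open_outer_region[OF ps]] sub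
      by blast
    then show ?thesis using sub dis by blast
  qed
  have "x \<in> closure (inner_region ps)" "x \<in> closure (outer_region ps)"
    using frontier_inner_region[OF ps] frontier_outer_region[OF ps] xs ab
    by (auto simp: frontier_def)
  then have "\<not> (half_disc x w e \<inter> inner_region ps = {} \<and> half_disc x (- w) e \<inter> inner_region ps = {})"
    "\<not> (half_disc x w e \<inter> outer_region ps = {} \<and> half_disc x (- w) e \<inter> outer_region ps = {})"
    using notin_closure_if_disjoint_half_discs[OF _ \<open>w \<noteq> 0\<close> e(1) e(1)]
      open_inner_region[OF ps] open_outer_region[OF ps] by blast+
  then have "half_disc x w e \<subseteq> inner_region ps \<and> half_disc x (- w) e \<subseteq> outer_region ps \<or>
    half_disc x (- w) e \<subseteq> inner_region ps \<and> half_disc x (- (- w)) e \<subseteq> outer_region ps"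
    using alt[of w] alt[of "- w"] by auto
  then show thesis using that[of w e] that[of "- w" e] e(1) by (auto simp: w_def)
qed

lemma side_subset_contour:
  assumes "{a, b} \<in> sides ps"
  shows "closed_segment a b \<subseteq> path_image (contour ps)"
proof -
  obtain k where k: "{a, b} = {ps ! k, next_vertex ps k}" "k < length ps"
    using assms by (auto simp: sides_def)
  then have "closed_segment a b = closed_segment (ps ! k) (next_vertex ps k)"
    by (simp add: segment_convex_hull)
  moreover have "ps \<noteq> []" using k by auto
  ultimately show ?thesis using k(2) unfolding path_image_contour[OF \<open>ps \<noteq> []\<close>] by blast
qed

lemma vertex_notin_open_side:
  assumes "{a, b} \<in> sides ps" "simple_polygon ps" "w \<in> open_segment a b"
  shows "w \<notin> set ps"
proof -
  obtain k where k: "{a, b} = {ps ! k, next_vertex ps k}" "k < length ps"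
    using assms by (auto simp: sides_def)
  then have "open_segment a b = open_segment (ps ! k) (next_vertex ps k)"
    by (auto simp: doubleton_eq_iff open_segment_commute)
  then show ?thesis using k assms simple_polygon_vertex_notin_open_segment by blast
qed

section \<open>Edges of a quadrangulation\<close>

locale bounded_quadrangulation =
  fixes Q :: "complex list set" and M :: "complex set" and vs :: "complex list"
  assumes polygon: "polygon M"
    and quadrangulation: "quadrangulation Q M"
    and boundary_contour: "boundary_contour Q M vs"
begin

lemma finite_Q: "finite Q"
  and simple: "q \<in> Q \<Longrightarrow> simple_polygon q"
  and length_Q: "q \<in> Q \<Longrightarrow> length q = 4"
  and M_eq: "M = (\<Union>q\<in>Q. region q)"
  using quadrangulation by (simp_all add: quadrangulation_def)

lemma simple_vs: "simple_polygon vs"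
  and set_vs: "set vs = vertices Q \<inter> frontier M"
  and contour_vs: "path_image (contour vs) = frontier M"
  and counterclockwise_vs: "z \<in> inner_region vs \<Longrightarrow> winding_number (contour vs) z = 1"
  using boundary_contour by (simp_all add: boundary_contour_def counterclockwise_def)

lemma M_eq_region: "M = region vs"
proof -
  obtain ps where "simple_polygon ps" "M = region ps" using polygon by (auto simp: polygon_def)
  then have "path_image (contour ps) = path_image (contour vs)"
    using frontier_region contour_vs by simp
  then show ?thesis using \<open>M = region ps\<close> by (simp add: region_def)
qed

lemma finite_vertices: "finite (vertices Q)"
  using finite_Q by (simp add: vertices_def)

text \<open>Disjointness extends to the contour of \<open>q'\<close>: an open set that misses the
  inside of \<open>q'\<close> misses its closure, which is the whole region.\<close>

lemma inner_regions_disjoint: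
  assumes "q \<in> Q" "q' \<in> Q" "z \<in> inner_region q" "z \<in> region q'"
  shows "q = q'"
proof (rule ccontr)
  assume "q \<noteq> q'"
  then have "interior (region q) \<inter> interior (region q') = {}"
    using quadrangulation assms by (auto simp: quadrangulation_def)
  then have "inner_region q \<inter> inner_region q' = {}"
    using inner_region_subset simple assms by blast
  then have "inner_region q \<inter> closure (inner_region q') = {}"
    using open_inner_region simple assms(1) by (simp add: open_Int_closure_eq_empty)
  then show False using assms closure_inner_region simple by auto
qed

lemma half_disc_in_two_faces:
  assumes "q \<in> Q" "q' \<in> Q" "v \<noteq> 0" "e > 0" "e' > 0"
    "half_disc x v e \<subseteq> inner_region q" "half_disc x v e' \<subseteq> inner_region q'"
  shows "q = q'"
proof -
  obtain z where "z \<in> half_disc x v (min e e')"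
    using half_disc_nonempty[of "min e e'" v x] assms by auto
  then have "z \<in> inner_region q" "z \<in> inner_region q'"
    using half_disc_mono[of "min e e'" e x v] half_disc_mono[of "min e e'" e' x v] assms by auto
  then show ?thesis using inner_regions_disjoint[of q q' z] assms by (auto simp: region_def)
qed

text \<open>At a point of the edge each of its faces fills one of two half discs, and two faces
  filling the same one would overlap. So \<open>v\<close>, which picks the half disc, is injective
  into a set of two normals.\<close>

lemma card_faces_at_edge:
  assumes "a \<noteq> b"
  shows "card {q \<in> Q. {a, b} \<in> sides q} \<le> 2"
proof -
  obtain x where x: "x \<in> open_segment a b" using assms by fastforce
  let ?w = "\<i> * (b - a)"
  have "\<exists>v e. (v = ?w \<or> v = - ?w) \<and> e > 0 \<and> half_disc x v e \<subseteq> inner_region q"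
    if "q \<in> Q" "{a, b} \<in> sides q" for q
    using half_discs[OF simple[OF that(1)] side_subset_contour[OF that(2)] x] by metis
  then obtain v where v: "\<And>q. q \<in> {q \<in> Q. {a, b} \<in> sides q} \<Longrightarrow>
     (v q = ?w \<or> v q = - ?w) \<and> (\<exists>e>0. half_disc x (v q) e \<subseteq> inner_region q)"
    by (metis (mono_tags, lifting) mem_Collect_eq)
  have "?w \<noteq> 0" using assms by simp
  have "inj_on v {q \<in> Q. {a, b} \<in> sides q}"
  proof (rule inj_onI)
    fix q q' assume q: "q \<in> {q \<in> Q. {a, b} \<in> sides q}" "q' \<in> {q \<in> Q. {a, b} \<in> sides q}" "v q = v q'"
    obtain e where "e > 0" "half_disc x (v q) e \<subseteq> inner_region q" using v[OF q(1)] by blast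
    moreover obtain e' where "e' > 0" "half_disc x (v q') e' \<subseteq> inner_region q'" using v[OF q(2)] by blast
    moreover have "v q \<noteq> 0" using v[OF q(1)] \<open>?w \<noteq> 0\<close> by auto
    ultimately show "q = q'" using half_disc_in_two_faces[of q q' "v q" e e' x] q by auto
  qed
  moreover have "v ` {q \<in> Q. {a, b} \<in> sides q} \<subseteq> {?w, - ?w}" using v by blast
  ultimately have "card {q \<in> Q. {a, b} \<in> sides q} \<le> card {?w, - ?w}"
    by (intro card_inj_on_le) auto
  also have "\<dots> \<le> 2" by (simp add: card_insert_if)
  finally show ?thesis .
qed

text \<open>Let \<open>w\<close> be a vertex of \<open>q'\<close>. One half disc at \<open>w\<close>
  lies in \<open>q\<close>, the opposite one in another quadrangle with the same side or outside
  \<open>M\<close>. Neither quadrangle is \<open>q'\<close>, as a simple polygon has no vertex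
  inside its own sides. Hence the inside of \<open>q'\<close> stays away from \<open>w\<close>,
  although \<open>w\<close> is on its contour.\<close>

lemma vertex_notin_open_edge:
  assumes q: "q \<in> Q" "{a, b} \<in> sides q" and w: "w \<in> vertices Q"
  shows "w \<notin> open_segment a b"
proof
  assume x: "w \<in> open_segment a b"
  obtain q' where q': "q' \<in> Q" "w \<in> set q'" using w by (auto simp: vertices_def)
  then obtain k where "k < length q'" "w = q' ! k" by (metis in_set_conv_nth)
  moreover have "q' \<noteq> []" using q' by auto
  moreover have "q' ! k \<in> closed_segment (q' ! k) (next_vertex q' k)" by simp
  ultimately have "w \<in> path_image (contour q')" using path_image_contour[of q'] by blast
  then have w': "w \<in> closure (inner_region q')"
    using closure_inner_region simple q' by (auto simp: region_def)
  have ab: "\<i> * (b - a) \<noteq> 0" using x by auto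
  have "q' \<noteq> q" using vertex_notin_open_side[OF q(2) simple[OF q(1)] x] q' by auto
  obtain v e where v: "v = \<i> * (b - a) \<or> v = - (\<i> * (b - a))" and e: "e > 0"
    "half_disc w v e \<subseteq> inner_region q"
    using half_discs[OF simple[OF q(1)] side_subset_contour[OF q(2)] x] by metis
  have v0: "v \<noteq> 0" using v ab by auto
  have U1: "half_disc w v e \<inter> inner_region q' = {}"
    using e inner_regions_disjoint[of q q'] q q' \<open>q' \<noteq> q\<close> by (auto simp: region_def)
  have "\<exists>e'>0. half_disc w (- v) e' \<inter> inner_region q' = {}"
  proof (cases "\<exists>q''\<in>Q. q'' \<noteq> q \<and> {a, b} \<in> sides q''")
    case True
    then obtain q'' where q'': "q'' \<in> Q" "q'' \<noteq> q" "{a, b} \<in> sides q''" by blast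
    have "q' \<noteq> q''" using vertex_notin_open_side[OF q''(3) simple[OF q''(1)] x] q' by auto
    obtain v' e' where v': "v' = \<i> * (b - a) \<or> v' = - (\<i> * (b - a))" and e': "e' > 0"
      "half_disc w v' e' \<subseteq> inner_region q''"
      using half_discs[OF simple[OF q''(1)] side_subset_contour[OF q''(3)] x] by metis
    have "v' \<noteq> v" using half_disc_in_two_faces[OF q(1) q''(1) v0 e(1) e'(1) e(2)] e'(2) q''(2) by auto
    then have "v' = - v" using v v' by auto
    then have "half_disc w (- v) e' \<inter> inner_region q' = {}"
      using e' inner_regions_disjoint[of q'' q'] q'' q' \<open>q' \<noteq> q''\<close> by (auto simp: region_def)
    then show ?thesis using e' by blast
  next
    \<comment> \<open>The side now lies on the frontier, though it is not yet known to be a side of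
      \<open>vs\<close>; the half discs are taken with respect to \<open>vs\<close>.\<close>
    case False
    have "(\<exists>q'\<in>Q. q' \<noteq> q \<and> {a, b} \<in> sides q') \<or> convex hull {a, b} \<subseteq> frontier M"
      using quadrangulation q unfolding quadrangulation_def by blast
    with False have "closed_segment a b \<subseteq> frontier M" by (metis segment_convex_hull)
    then have fr: "closed_segment a b \<subseteq> path_image (contour vs)" using contour_vs by simp
    obtain v' e' where v': "v' = \<i> * (b - a) \<or> v' = - (\<i> * (b - a))" and e': "e' > 0"
      "half_disc w (- v') e' \<subseteq> outer_region vs"
      using half_discs[OF simple_vs fr x] by metis
    \<comment> \<open>Otherwise the half disc inside \<open>q\<close> would meet the complement of
      \<open>M\<close>.\<close>
    have "v' = v"
    proof (rule ccontr)
      assume "v' \<noteq> v"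
      then have "- v' = v" using v v' by auto
      then have "half_disc w v e' \<inter> M = {}" using e' outer_region_eq M_eq_region by auto
      moreover have "half_disc w v e \<subseteq> M" using e q M_eq by (auto simp: region_def)
      ultimately show False
        using half_disc_mono[of "min e e'" e w v] half_disc_mono[of "min e e'" e' w v]
         half_disc_nonempty[of "min e e'" v w] e e' v0 by auto
    qed
    then have "half_disc w (- v) e' \<inter> inner_region q' = {}"
      using e' outer_region_eq M_eq_region M_eq q' by (auto simp: region_def)
    then show ?thesis using e' by blast
  qed
  then obtain e' where "e' > 0" "half_disc w (- v) e' \<inter> inner_region q' = {}" by blast
  then show False
    using notin_closure_if_disjoint_half_discs[OF open_inner_region[OF simple[OF q'(1)]] v0 e(1) _ U1]
      w' by blast
qed

text \<open>Here it matters that \<open>vs\<close> lists all vertices on the frontier, including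
  those within a straight piece of it.\<close>

lemma vertex_notin_open_boundary_side:
  assumes "{a, b} \<in> sides vs" "w \<in> vertices Q"
  shows "w \<notin> open_segment a b"
proof
  assume w: "w \<in> open_segment a b"
  then have "w \<in> frontier M"
    using side_subset_contour[OF assms(1)] contour_vs segment_open_subset_closed[of a b] by blast
  then have "w \<in> set vs" using set_vs assms by auto
  then show False using vertex_notin_open_side[OF assms(1) simple_vs w] by auto
qed

end

section \<open>Chains of oriented segments\<close>

lemma affine_in_closed_segment_iff:
  fixes x d :: complex
  assumes "d \<noteq> 0"
  shows "x + r * d \<in> closed_segment (x + p * d) (x + q * d) \<longleftrightarrow> r \<in> closed_segment p q"
proof -
  have "(1 - u) *\<^sub>R (x + p * d) + u *\<^sub>R (x + q * d) = x + ((1 - u) *\<^sub>R p + u *\<^sub>R q) * d" for u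
    by (simp add: algebra_simps)
  then show ?thesis using assms by (simp add: in_segment)
qed

text \<open>The segment is completed to a counterclockwise triangle with apex \<open>c\<close>. The
  triangle has winding number 1 just left of the segment and 0 just right of it, while the share
  \<open>g\<close> of the other two sides is continuous at \<open>x\<close>; so the segment alone
  causes the jump.\<close>

lemma winding_number_linepath_jump:
  assumes x: "x \<in> open_segment a b"
  shows "((\<lambda>t. winding_number (linepath a b) (x + of_real t * (\<i> * (b - a))) -
               winding_number (linepath a b) (x - of_real t * (\<i> * (b - a)))) \<longlongrightarrow> 1) (at_right 0)"
proof -
  define d where "d = b - a"
  obtain u where u: "0 < u" "u < 1" and xu: "x = (1 - u) *\<^sub>R a + u *\<^sub>R b" and "a \<noteq> b"
    using x by (auto simp: in_segment)
  have "d \<noteq> 0" using \<open>a \<noteq> b\<close> by (simp add: d_def)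
  have a: "a = x + of_real (- u) * d" and b: "b = x + of_real (1 - u) * d"
    by (simp_all add: xu d_def scaleR_conv_of_real algebra_simps)
  define c where "c = x + \<i> * d"
  define zp where "zp = (\<lambda>t::real. x + (of_real t * \<i>) * d)"
  define zm where "zm = (\<lambda>t::real. x + (of_real (- t) * \<i>) * d)"
  define g where "g = (\<lambda>z. winding_number (linepath b c) z + winding_number (linepath c a) z)"
  have x0: "x = x + 0 * d" by simp
  \<comment> \<open>With \<open>x\<close> as origin and \<open>d\<close> as unit, the corners are
    \<open>- u\<close>, \<open>1 - u\<close> and \<open>\<i>\<close>, and \<open>zp t\<close>,
    \<open>zm t\<close> become \<open>t * \<i>\<close> and \<open>- t * \<i>\<close>.\<close>
  have seg: "x + r * d \<notin> closed_segment a b \<longleftrightarrow> r \<notin> closed_segment (of_real (- u)) (of_real (1 - u))"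
       "x + r * d \<notin> closed_segment b c \<longleftrightarrow> r \<notin> closed_segment (of_real (1 - u)) \<i>"
       "x + r * d \<notin> closed_segment c a \<longleftrightarrow> r \<notin> closed_segment \<i> (of_real (- u))" for r
    using \<open>d \<noteq> 0\<close> by (simp_all only: a b c_def affine_in_closed_segment_iff not_False_eq_True)
  have off: "zp t \<notin> closed_segment a b" "zp t \<notin> closed_segment b c" "zp t \<notin> closed_segment c a"
      "zm t \<notin> closed_segment a b" "zm t \<notin> closed_segment b c" "zm t \<notin> closed_segment c a"
    if "0 < t" "t < 1" for t
    unfolding zp_def zm_def seg using that u by (auto simp: in_segment complex_eq_iff)
  have x_off: "x \<notin> closed_segment b c" "x \<notin> closed_segment c a"
    using seg(2,3)[of 0] u by (auto simp: in_segment complex_eq_iff)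
  have "continuous (at x) g"
    unfolding g_def using x_off by (intro continuous_intros continuous_at_winding_number) auto
  then have g: "(g \<longlongrightarrow> g x) (at x)" by (simp add: isCont_def)
  have lim: "filterlim zp (at x) (at_right 0)" "filterlim zm (at x) (at_right 0)"
    unfolding zp_def zm_def using \<open>d \<noteq> 0\<close>
    by (auto simp: filterlim_at eventually_at_filter intro!: tendsto_eq_intros)
  have wp: "winding_number (linepath a b) (zp t) = 1 - g (zp t)" if t: "0 < t" "t < 1" for t
  proof -
    note o = off[OF t]
    have n: "d * cnj d = of_real ((norm d)\<^sup>2)" by (simp only: complex_norm_square)
    have pos: "0 < Im (w * of_real ((norm d)\<^sup>2))" if "0 < Im w" for w
      using that \<open>d \<noteq> 0\<close> by simp
    have e1: "(b - a) * cnj (b - zp t) = (of_real (1 - u) + of_real t * \<i>) * (d * cnj d)"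
      by (simp add: a b zp_def algebra_simps)
    have e2: "(c - b) * cnj (c - zp t) = ((\<i> - of_real (1 - u)) * (- \<i> * of_real (1 - t))) * (d * cnj d)"
      by (simp add: c_def b zp_def algebra_simps)
    have e3: "(a - c) * cnj (a - zp t) = ((- of_real u - \<i>) * (- of_real u + of_real t * \<i>)) * (d * cnj d)"
      by (simp add: a c_def zp_def algebra_simps)
    \<comment> \<open>A positive imaginary part puts \<open>zp t\<close> to the left of the side,
      whose winding number then has positive real part. The factor \<open>d * cnj d\<close> is
      positive and can be ignored.\<close>
    have im: "0 < Im ((b - a) * cnj (b - zp t))" "0 < Im ((c - b) * cnj (c - zp t))"
      "0 < Im ((a - c) * cnj (a - zp t))"
      unfolding e1 e2 e3 n using t mult_pos_pos[of "1 - u" "1 - t"] mult_pos_pos[of u "1 - t"] u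
      by (intro pos; simp add: algebra_simps)+
    let ?T = "linepath a b +++ linepath b c +++ linepath c a"
    have split: "winding_number ?T (zp t) = winding_number (linepath a b) (zp t) + g (zp t)"
      using o by (simp add: winding_number_join path_image_join g_def)
    have gt0: "0 < Re (winding_number ?T (zp t))"
      using im o by (simp add: winding_number_linepath_pos_lt path_image_join winding_number_join_pos_combined)
    \<comment> \<open>Each side contributes less than 1/2, so the total is below 3/2; together with
      \<open>gt0\<close> integrality leaves only 1.\<close>
    have lt2: "Re (winding_number ?T (zp t)) < 2"
      using winding_number_lt_half_linepath[OF o(1)] winding_number_lt_half_linepath[OF o(2)]
        winding_number_lt_half_linepath[OF o(3)] unfolding split by (simp add: g_def)
    have "winding_number ?T (zp t) = 1"
      using o by (intro winding_number_eq_1) (simp_all add: path_image_join gt0 lt2)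
    then show ?thesis using split by (simp add: algebra_simps)
  qed
  have wm: "winding_number (linepath a b) (zm t) = - g (zm t)" if t: "0 < t" "t < 1" for t
  proof -
    note o = off[OF t]
    let ?T = "linepath a b +++ linepath b c +++ linepath c a"
    \<comment> \<open>The half-plane to the left of the segment: it contains the triangle but not
      \<open>zm t\<close>.\<close>
    let ?H = "{z. (\<i> * d) \<bullet> z \<ge> (\<i> * d) \<bullet> x}"
    have perp: "(\<i> * d) \<bullet> (of_real r * d) = 0" for r by (simp add: inner_complex_def)
    have "a \<in> ?H" "b \<in> ?H" "c \<in> ?H"
      using perp[of "- u"] perp[of "1 - u"] by (simp_all add: a b c_def inner_add_right inner_diff_right)
    then have "path_image ?T \<subseteq> ?H"
      using closed_segment_subset[of _ ?H, OF _ _ convex_halfspace_ge]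
      by (simp add: path_image_join)
    moreover have "zm t \<notin> ?H"
    proof -
      have "(\<i> * d) \<bullet> ((of_real (- t) * \<i>) * d) = - t * ((\<i> * d) \<bullet> (\<i> * d))"
        by (simp add: inner_complex_def algebra_simps)
      also have "\<dots> < 0" using t \<open>d \<noteq> 0\<close> by (simp add: inner_gt_zero_iff)
      finally show ?thesis by (simp add: zm_def inner_add_right inner_diff_right)
    qed
    ultimately have "winding_number ?T (zm t) = 0"
      by (intro winding_number_zero_outside[of _ ?H]) (auto simp: convex_halfspace_ge)
    moreover have "winding_number ?T (zm t) = winding_number (linepath a b) (zm t) + g (zm t)"
      using o by (simp add: winding_number_join path_image_join g_def)
    ultimately show ?thesis by (simp add: eq_neg_iff_add_eq_0)
  qed
  have "((\<lambda>t. (1 - g (zp t)) - (- g (zm t))) \<longlongrightarrow> (1 - g x) - (- g x)) (at_right 0)"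
    by (intro tendsto_intros filterlim_compose[OF g] lim)
  moreover have "\<forall>\<^sub>F t in at_right 0. (1 - g (zp t)) - (- g (zm t)) =
     winding_number (linepath a b) (zp t) - winding_number (linepath a b) (zm t)"
    using eventually_at_right_real[of 0 1] by (auto elim!: eventually_mono simp: wp wm)
  ultimately have "((\<lambda>t. winding_number (linepath a b) (zp t) - winding_number (linepath a b) (zm t))
     \<longlongrightarrow> 1) (at_right 0)"
    using Lim_transform_eventually by fastforce
  then show ?thesis by (simp add: zp_def zm_def d_def mult.assoc)
qed

text \<open>Reversal negates the winding number of a segment, so both orientations of the edge
  together contribute \<open>N (a, b) - N (b, a)\<close> times that of \<open>linepath a b\<close>.
  All other terms are continuous at \<open>x\<close>. The jump of the sum is therefore this
  difference, but the sum is 0 on both sides.\<close>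

lemma chain_coefficient_symmetric:
  fixes N :: "complex \<times> complex \<Rightarrow> complex"
  assumes E: "finite E" "(a, b) \<in> E" "(b, a) \<in> E" and x: "x \<in> open_segment a b"
    and others: "\<And>c d. (c, d) \<in> E \<Longrightarrow> {c, d} \<noteq> {a, b} \<Longrightarrow> x \<notin> closed_segment c d"
    and W: "\<And>z. (\<And>c d. (c, d) \<in> E \<Longrightarrow> z \<notin> closed_segment c d) \<Longrightarrow>
      (\<Sum>(c, d)\<in>E. N (c, d) * winding_number (linepath c d) z) = 0"
  shows "N (a, b) = N (b, a)"
proof -
  define P where "P = {(c, d) \<in> E. {c, d} \<noteq> {a, b}}"
  define R where "R = (\<lambda>z. \<Sum>(c, d)\<in>P. N (c, d) * winding_number (linepath c d) z)"
  have "a \<noteq> b" using x by auto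
  have finP: "finite P" using E(1) by (auto simp: P_def intro: finite_subset[of _ E])
  have EP: "E = P \<union> {(a, b), (b, a)}" "P \<inter> {(a, b), (b, a)} = {}"
    using E by (auto simp: P_def doubleton_eq_iff)
  have eq: "R z + (N (a, b) - N (b, a)) * winding_number (linepath a b) z = 0"
    if "\<And>c d. (c, d) \<in> E \<Longrightarrow> z \<notin> closed_segment c d" for z
  proof -
    have "z \<notin> closed_segment a b" using that E by blast
    then have "winding_number (linepath b a) z = - winding_number (linepath a b) z"
      using winding_number_reversepath[of "linepath a b" z] by simp
    moreover have "(\<Sum>(c, d)\<in>E. N (c, d) * winding_number (linepath c d) z) =
      R z + (\<Sum>(c, d)\<in>{(a, b), (b, a)}. N (c, d) * winding_number (linepath c d) z)"
      unfolding R_def EP(1) using EP(2) finP by (intro sum.union_disjoint) auto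
    ultimately show ?thesis using W[OF that] \<open>a \<noteq> b\<close> by (simp add: algebra_simps)
  qed
  have P_off: "x \<notin> closed_segment c d" if "(c, d) \<in> P" for c d
    using that others by (auto simp: P_def)
  have "continuous (at x) R"
    unfolding R_def case_prod_beta using P_off
    by (intro continuous_intros continuous_at_winding_number) auto
  then have R: "(R \<longlongrightarrow> R x) (at x)" by (simp add: isCont_def)
  \<comment> \<open>The sum is known to vanish only off all segments, so the points approaching
    \<open>x\<close> must avoid the other segments as well.\<close>
  have ev: "\<forall>\<^sub>F z in at x. \<forall>p\<in>P. z \<notin> closed_segment (fst p) (snd p)"
  proof (rule eventually_ball_finite[OF finP], intro ballI)
    fix p assume "p \<in> P"
    then have "x \<in> - closed_segment (fst p) (snd p)" using P_off[of "fst p" "snd p"] by simp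
    then show "\<forall>\<^sub>F z in at x. z \<notin> closed_segment (fst p) (snd p)"
      using eventually_at_in_open'[of "- closed_segment (fst p) (snd p)" x]
      by (simp add: open_Compl)
  qed
  define zp where "zp = (\<lambda>t::real. x + of_real t * (\<i> * (b - a)))"
  define zm where "zm = (\<lambda>t::real. x - of_real t * (\<i> * (b - a)))"
  have lim: "filterlim zp (at x) (at_right 0)" "filterlim zm (at x) (at_right 0)"
    unfolding zp_def zm_def using \<open>a \<noteq> b\<close>
    by (auto simp: filterlim_at eventually_at_filter intro!: tendsto_eq_intros)
  have ab_off: "zp t \<notin> closed_segment a b" "zm t \<notin> closed_segment a b" if "t > 0" for t
  proof -
    obtain u where xu: "x = (1 - u) *\<^sub>R a + u *\<^sub>R b" using x by (auto simp: in_segment)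
    have d: "b - a \<noteq> 0" using \<open>a \<noteq> b\<close> by simp
    have ab: "closed_segment a b = closed_segment (x + of_real (- u) * (b - a)) (x + of_real (1 - u) * (b - a))"
      by (rule arg_cong2[of _ _ _ _ closed_segment]) (simp_all add: xu scaleR_conv_of_real algebra_simps)
    have z: "zp t = x + (of_real t * \<i>) * (b - a)" "zm t = x + (of_real (- t) * \<i>) * (b - a)"
      by (simp_all add: zp_def zm_def)
    show "zp t \<notin> closed_segment a b" "zm t \<notin> closed_segment a b"
      unfolding ab z affine_in_closed_segment_iff[OF d]
      using that by (auto simp: in_segment complex_eq_iff)
  qed
  have off: "z \<notin> closed_segment c d"
    if "\<forall>p\<in>P. z \<notin> closed_segment (fst p) (snd p)" "z \<notin> closed_segment a b" "(c, d) \<in> E" for z c d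
  proof -
    have "(c, d) \<in> P \<or> closed_segment c d = closed_segment a b"
      using that(3) EP(1) closed_segment_commute[of b a] by auto
    then show ?thesis using that(1,2) by (metis fst_conv snd_conv)
  qed
  have "((\<lambda>t. (R (zp t) - R (zm t)) + (N (a, b) - N (b, a)) *
      (winding_number (linepath a b) (zp t) - winding_number (linepath a b) (zm t)))
      \<longlongrightarrow> (R x - R x) + (N (a, b) - N (b, a)) * 1) (at_right 0)"
    unfolding zp_def zm_def
    by (intro tendsto_intros filterlim_compose[OF R] lim[unfolded zp_def zm_def] winding_number_linepath_jump x)
  moreover have "\<forall>\<^sub>F t in at_right 0. (R (zp t) - R (zm t)) + (N (a, b) - N (b, a)) *
      (winding_number (linepath a b) (zp t) - winding_number (linepath a b) (zm t)) = 0"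
    using eventually_compose_filterlim[OF ev lim(1)] eventually_compose_filterlim[OF ev lim(2)]
      eventually_at_right_less[of "0::real"]
  proof eventually_elim
    case (elim t)
    have "R (zp t) = - ((N (a, b) - N (b, a)) * winding_number (linepath a b) (zp t))"
      using eq[OF off[OF elim(1) ab_off(1)[OF elim(3)]]] by (simp only: eq_neg_iff_add_eq_0)
    moreover have "R (zm t) = - ((N (a, b) - N (b, a)) * winding_number (linepath a b) (zm t))"
      using eq[OF off[OF elim(2) ab_off(2)[OF elim(3)]]] by (simp only: eq_neg_iff_add_eq_0)
    ultimately show ?case by (simp add: right_diff_distrib)
  qed
  ultimately have "((\<lambda>t. 0) \<longlongrightarrow> (R x - R x) + (N (a, b) - N (b, a)) * 1) (at_right (0::real))"
    by (rule Lim_transform_eventually)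
  then show ?thesis by (simp add: tendsto_const_iff)
qed

text \<open>Two common points force the segments onto one line. There, overlapping segments of which
  neither has an end point inside the other coincide.\<close>

lemma finite_open_segment_Int_closed_segment:
  fixes a b c d :: complex
  assumes "{a, b} \<noteq> {c, d}" "a \<notin> open_segment c d" "b \<notin> open_segment c d"
    "c \<notin> open_segment a b" "d \<notin> open_segment a b"
  shows "finite (open_segment a b \<inter> closed_segment c d)"
proof -
  have *: "{a, b} = {c, d}" if x: "x \<in> open_segment a b" "x \<in> closed_segment c d"
    and y: "y \<in> open_segment a b" "y \<in> closed_segment c d" and "x \<noteq> y" for x y
  proof -
    let ?e = "b - a"
    obtain s where s: "0 < s" "s < 1" "x = a + s *\<^sub>R ?e" and "a \<noteq> b"
      using x(1) by (auto simp: in_segment algebra_simps)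
    obtain t where t: "y = a + t *\<^sub>R ?e" using y(1) by (auto simp: in_segment algebra_simps)
    obtain \<sigma> where \<sigma>: "0 \<le> \<sigma>" "\<sigma> \<le> 1" "x = c + \<sigma> *\<^sub>R (d - c)"
      using x(2) by (auto simp: in_segment algebra_simps)
    obtain \<tau> where \<tau>: "y = c + \<tau> *\<^sub>R (d - c)" using y(2) by (auto simp: in_segment algebra_simps)
    have "(\<tau> - \<sigma>) *\<^sub>R (d - c) = (t - s) *\<^sub>R ?e"
      using s(3) t \<sigma>(3) \<tau> by (metis add_diff_cancel_left scaleR_left_diff_distrib)
    moreover have "\<tau> \<noteq> \<sigma>" using \<open>x \<noteq> y\<close> \<sigma> \<tau> by auto
    ultimately have "d - c = ((t - s) / (\<tau> - \<sigma>)) *\<^sub>R ?e"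
      by (metis (no_types, lifting) divide_inverse_commute eq_iff_diff_eq_0 real_vector_eq_affinity scaleR_scaleR vector_fraction_eq_iff)
    then obtain \<kappa> where \<kappa>: "d - c = \<kappa> *\<^sub>R ?e" by blast
    \<comment> \<open>The positions of \<open>c\<close> and \<open>d\<close> on the line, with
      \<open>a\<close> at 0 and \<open>b\<close> at 1. The position \<open>s\<close> of
      \<open>x\<close> is strictly between 0 and 1 and also between \<open>\<alpha>\<close> and
      \<open>\<beta>\<close>, which leaves only 0 and 1 for these two.\<close>
    define \<alpha> \<beta> where "\<alpha> = s - \<sigma> * \<kappa>" and "\<beta> = \<alpha> + \<kappa>"
    have c: "c = a + \<alpha> *\<^sub>R ?e" using s(3) \<sigma>(3) \<kappa> by (simp add: \<alpha>_def algebra_simps)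
    have "d = c + (d - c)" by simp
    also have "\<dots> = a + \<beta> *\<^sub>R ?e" unfolding \<kappa> by (subst c) (simp add: \<beta>_def scaleR_left_distrib)
    finally have d: "d = a + \<beta> *\<^sub>R ?e" .
    have in_ab: "a + r *\<^sub>R ?e \<in> open_segment a b" if "0 < r" "r < 1" for r
      using that \<open>a \<noteq> b\<close> unfolding in_segment by (auto intro!: exI[of _ r] simp: algebra_simps)
    have "\<not> (0 < \<alpha> \<and> \<alpha> < 1)" "\<not> (0 < \<beta> \<and> \<beta> < 1)" using in_ab assms(4,5) c d by auto
    have s_eq: "s = (1 - \<sigma>) * \<alpha> + \<sigma> * \<beta>" by (simp add: \<beta>_def \<alpha>_def algebra_simps)
    have in_cd: "a + r *\<^sub>R ?e \<in> open_segment c d" if "\<alpha> < r \<and> r < \<beta> \<or> \<beta> < r \<and> r < \<alpha>" for r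
    proof -
      have "\<alpha> \<noteq> \<beta>" using that by auto
      then have "c \<noteq> d" using c d \<open>a \<noteq> b\<close> by auto
      define u where "u = (r - \<alpha>) / (\<beta> - \<alpha>)"
      have r: "r = (1 - u) * \<alpha> + u * \<beta>" using \<open>\<alpha> \<noteq> \<beta>\<close>
        by (simp add: u_def divide_simps) (simp add: algebra_simps)
      then have "a + r *\<^sub>R ?e = (1 - u) *\<^sub>R c + u *\<^sub>R d"
        by (subst c, subst d, subst r) (simp add: algebra_simps)
      moreover have "0 < u" "u < 1" using that by (auto simp: u_def divide_simps)
      ultimately show ?thesis using \<open>c \<noteq> d\<close> unfolding in_segment by blast
    qed
    have no: "\<not> (\<alpha> < 0 \<and> 0 < \<beta> \<or> \<beta> < 0 \<and> 0 < \<alpha>)" "\<not> (\<alpha> < 1 \<and> 1 < \<beta> \<or> \<beta> < 1 \<and> 1 < \<alpha>)"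
      using in_cd[of 0] in_cd[of 1] assms(2,3) by auto
    have "\<not> (\<alpha> \<le> 0 \<and> \<beta> \<le> 0)"
      using s_eq \<sigma> s by (smt (verit) mult_nonneg_nonpos)
    moreover have "\<not> (\<alpha> \<ge> 1 \<and> \<beta> \<ge> 1)"
    proof
      assume "\<alpha> \<ge> 1 \<and> \<beta> \<ge> 1"
      then have "(1 - \<sigma>) * \<alpha> \<ge> (1 - \<sigma>) * 1" "\<sigma> * \<beta> \<ge> \<sigma> * 1" using \<sigma> by (intro mult_left_mono; simp)+
      then show False using s_eq s by simp
    qed
    ultimately have "\<alpha> = 0 \<and> \<beta> = 1 \<or> \<alpha> = 1 \<and> \<beta> = 0"
      using no \<open>\<not> (0 < \<alpha> \<and> \<alpha> < 1)\<close> \<open>\<not> (0 < \<beta> \<and> \<beta> < 1)\<close> by linarith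
    then show ?thesis using c d by auto
  qed
  have "open_segment a b \<inter> closed_segment c d \<subseteq> {SOME x. x \<in> open_segment a b \<inter> closed_segment c d}"
    using * assms(1) by (metis (no_types, lifting) IntE insertI1 someI subsetI)
  then show ?thesis by (rule finite_subset) simp
qed

section \<open>Sums along closed contours\<close>

definition cycle_sum :: "(complex \<Rightarrow> complex \<Rightarrow> 'a) \<Rightarrow> complex list \<Rightarrow> 'a::comm_monoid_add" where
  "cycle_sum F ps = (\<Sum>k<length ps. F (ps ! k) (next_vertex ps k))"

text \<open>Complex valued, so that the counts can be coefficients of winding numbers.\<close>

definition traversals :: "complex list \<Rightarrow> complex \<times> complex \<Rightarrow> complex" where
  "traversals ps p = cycle_sum (\<lambda>u v. if p = (u, v) then 1 else 0) ps"

lemma next_vertex_in_set: "k < length ps \<Longrightarrow> next_vertex ps k \<in> set ps"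
  unfolding next_vertex_def by (intro nth_mem mod_less_divisor) auto

lemma side_eq_nth: "k < length ps \<Longrightarrow> {ps ! k, next_vertex ps k} \<in> sides ps"
  by (auto simp: sides_def)

text \<open>A reversed side would bring the contour back after two steps, but it has at least three
  distinct vertices.\<close>

lemma simple_polygon_side_not_reversed:
  assumes ps: "simple_polygon ps" and k: "k < length ps" and j: "j < length ps"
  shows "\<not> (ps ! j = next_vertex ps k \<and> next_vertex ps j = ps ! k)"
proof
  let ?n = "length ps"
  have n: "?n \<ge> 3" "distinct ps" using ps simple_polygon_distinct by (auto simp: simple_polygon_def)
  assume *: "ps ! j = next_vertex ps k \<and> next_vertex ps j = ps ! k"
  have "?n > 0" using n(1) by linarith
  then have "Suc k mod ?n < ?n" "Suc j mod ?n < ?n" by (rule mod_less_divisor)+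
  then have "j = Suc k mod ?n" "Suc j mod ?n = k"
    using * k n j by (auto simp: next_vertex_def nth_eq_iff_index_eq)
  then show False using n k by (auto simp: mod_Suc split: if_splits)
qed

lemma inj_on_sides:
  assumes "simple_polygon ps"
  shows "inj_on (\<lambda>k. {ps ! k, next_vertex ps k}) {..<length ps}"
proof (rule inj_onI)
  fix k j assume k: "k \<in> {..<length ps}" "j \<in> {..<length ps}"
    "{ps ! k, next_vertex ps k} = {ps ! j, next_vertex ps j}"
  then have "ps ! k = ps ! j"
    using simple_polygon_side_not_reversed[OF assms, of k j] by (auto simp: doubleton_eq_iff)
  then show "k = j" using k simple_polygon_distinct[OF assms] by (simp add: nth_eq_iff_index_eq)
qed

text \<open>Indexing by a common set of oriented segments, rather than by positions, lets different
  contours be added to one chain.\<close>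

lemma cycle_sum_eq_sum_traversals:
  fixes G :: "complex \<Rightarrow> complex \<Rightarrow> complex"
  assumes "finite E" "\<And>k. k < length ps \<Longrightarrow> (ps ! k, next_vertex ps k) \<in> E"
  shows "cycle_sum G ps = (\<Sum>p\<in>E. traversals ps p * case_prod G p)"
proof -
  have "(\<Sum>p\<in>E. traversals ps p * case_prod G p) =
    (\<Sum>p\<in>E. \<Sum>k<length ps. if p = (ps ! k, next_vertex ps k) then case_prod G p else 0)"
    unfolding traversals_def cycle_sum_def sum_distrib_right by (intro sum.cong) auto
  also have "\<dots> = (\<Sum>k<length ps. \<Sum>p\<in>E. if p = (ps ! k, next_vertex ps k) then case_prod G p else 0)"
    by (rule sum.swap)
  also have "\<dots> = (\<Sum>k<length ps. G (ps ! k) (next_vertex ps k))"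
    using assms by (intro sum.cong) (auto simp: sum.delta)
  finally show ?thesis by (simp add: cycle_sum_def)
qed

text \<open>Swapping all pairs turns the sum into its own negative.\<close>

lemma sum_antisymmetric_eq_0:
  fixes F :: "'a \<Rightarrow> 'a \<Rightarrow> 'b::{field_char_0}"
  assumes "\<And>a b. (a, b) \<in> E \<Longrightarrow> (b, a) \<in> E" "\<And>a b. F b a = - F a b"
    and "\<And>a b. (a, b) \<in> E \<Longrightarrow> N (a, b) = N (b, a)"
  shows "(\<Sum>p\<in>E. N p * case_prod F p) = 0"
proof -
  have "(\<Sum>p\<in>E. N p * case_prod F p) = (\<Sum>p\<in>E. - (N p * case_prod F p))"
  proof (rule sum.reindex_bij_witness[of _ prod.swap prod.swap])
    fix p assume p: "p \<in> E"
    obtain a b where ab: "p = (a, b)" by (cases p)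
    have "F b a = - F a b" "N (a, b) = N (b, a)" using assms(2)[of b a] assms(3) p ab by auto
    then show "- (N (prod.swap p) * case_prod F (prod.swap p)) = N p * case_prod F p" by (simp add: ab)
  qed (use assms(1) in auto)
  then have "(\<Sum>p\<in>E. N p * case_prod F p) = - (\<Sum>p\<in>E. N p * case_prod F p)"
    by (simp add: sum_negf)
  then show ?thesis by simp
qed

lemma winding_sign_exists:
  assumes "simple_polygon ps"
  shows "\<exists>s::int. (s = 1 \<or> s = - 1) \<and> (\<forall>z\<in>inner_region ps. winding_number (contour ps) z = of_int s)"
proof -
  have "simple_path (contour ps)" using assms by (simp add: simple_polygon_def)
  then show ?thesis
    by (rule simple_closed_path_winding_number_inside) (force intro: exI[of _ 1] exI[of _ "- 1"])+
qed

section \<open>Cancellation of the quadrangles against the boundary\<close>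

context bounded_quadrangulation
begin

lemma Q_nonempty: "q \<in> Q \<Longrightarrow> q \<noteq> []"
  using length_Q by fastforce

lemma vs_nonempty: "vs \<noteq> []"
  using simple_vs by (auto simp: simple_polygon_def)

text \<open>The sides of \<open>vs\<close> are added separately, since it only follows from the
  cancellation that they are edges of \<open>Q\<close>.\<close>

definition oriented_edges :: "(complex \<times> complex) set" where
  "oriented_edges = {(a, b). {a, b} \<in> edges Q \<union> sides vs}"

lemma oriented_edges_subset: "oriented_edges \<subseteq> vertices Q \<times> vertices Q"
proof -
  have "e \<subseteq> set ps" if "e \<in> sides ps" for e ps
    using that next_vertex_in_set by (auto simp: sides_def)
  then have "e \<subseteq> vertices Q" if "e \<in> edges Q \<union> sides vs" for e
    using that set_vs by (fastforce simp: edges_def vertices_def)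
  then show ?thesis by (auto simp: oriented_edges_def)
qed

lemma finite_oriented_edges: "finite oriented_edges"
  using finite_subset[OF oriented_edges_subset] finite_vertices by simp

lemma oriented_edges_swap: "(a, b) \<in> oriented_edges \<Longrightarrow> (b, a) \<in> oriented_edges"
  by (simp add: oriented_edges_def insert_commute)

lemma oriented_edges_no_vertex:
  assumes "(a, b) \<in> oriented_edges" "w \<in> vertices Q"
  shows "w \<notin> open_segment a b"
  using assms vertex_notin_open_edge vertex_notin_open_boundary_side
  by (auto simp: oriented_edges_def edges_def)

lemma oriented_edges_distinct:
  assumes "(a, b) \<in> oriented_edges"
  shows "a \<noteq> b"
proof -
  have "ps ! k \<noteq> next_vertex ps k" if "simple_polygon ps" "k < length ps" for ps k
  proof -
    have "Suc k mod length ps \<noteq> k" "Suc k mod length ps < length ps"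
      using that by (auto simp: simple_polygon_def mod_Suc)
    then show ?thesis
      using simple_polygon_distinct[OF that(1)] that(2) by (simp add: next_vertex_def nth_eq_iff_index_eq)
  qed
  moreover obtain ps k where "simple_polygon ps" "k < length ps" "{a, b} = {ps ! k, next_vertex ps k}"
    using assms simple simple_vs by (fastforce simp: oriented_edges_def edges_def sides_def)
  ultimately show ?thesis by (metis doubleton_eq_iff)
qed

text \<open>The finitely many other edges meet the open edge in finite sets, because no vertex lies
  inside an edge; they cannot exhaust an infinite segment.\<close>

lemma generic_point_on_edge:
  assumes "(a, b) \<in> oriented_edges"
  obtains x where "x \<in> open_segment a b"
    "\<And>c d. (c, d) \<in> oriented_edges \<Longrightarrow> {c, d} \<noteq> {a, b} \<Longrightarrow> x \<notin> closed_segment c d"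
proof -
  let ?O = "{p \<in> oriented_edges. {fst p, snd p} \<noteq> {a, b}}"
  let ?X = "\<lambda>p. open_segment a b \<inter> closed_segment (fst p) (snd p)"
  have "finite (?X p)" if "p \<in> ?O" for p
  proof (rule finite_open_segment_Int_closed_segment)
    have p: "(fst p, snd p) \<in> oriented_edges" "{fst p, snd p} \<noteq> {a, b}" using that by auto
    then show "{a, b} \<noteq> {fst p, snd p}" by metis
    show "a \<notin> open_segment (fst p) (snd p)" "b \<notin> open_segment (fst p) (snd p)"
      using oriented_edges_no_vertex[OF p(1)] assms oriented_edges_subset by blast+
    show "fst p \<notin> open_segment a b" "snd p \<notin> open_segment a b"
      using oriented_edges_no_vertex[OF assms] p(1) oriented_edges_subset by blast+
  qed
  moreover have "finite ?O" using finite_oriented_edges by simp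
  ultimately have "finite (\<Union>p\<in>?O. ?X p)" by (intro finite_UN_I)
  moreover have "infinite (open_segment a b)" using oriented_edges_distinct[OF assms] by simp
  ultimately have "\<not> open_segment a b \<subseteq> (\<Union>p\<in>?O. ?X p)" using finite_subset by blast
  then obtain x where x: "x \<in> open_segment a b" "x \<notin> (\<Union>p\<in>?O. ?X p)" by blast
  have "x \<notin> closed_segment c d" if "(c, d) \<in> oriented_edges" "{c, d} \<noteq> {a, b}" for c d
  proof -
    have "(c, d) \<in> ?O" using that by simp
    then have "x \<notin> ?X (c, d)" using x(2) by blast
    then show ?thesis using x(1) by simp
  qed
  with x(1) show thesis by (rule that)
qed

text \<open>The factor that makes a contour listed in either direction count as
  counterclockwise.\<close>

definition winding_sign :: "complex list \<Rightarrow> int" where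
  "winding_sign q = (SOME s. (s = 1 \<or> s = - 1) \<and>
     (\<forall>z\<in>inner_region q. winding_number (contour q) z = of_int s))"

lemma winding_sign:
  assumes "q \<in> Q"
  shows "winding_sign q = 1 \<or> winding_sign q = - 1"
    "z \<in> inner_region q \<Longrightarrow> winding_number (contour q) z = of_int (winding_sign q)"
  using someI_ex[OF winding_sign_exists[OF simple[OF assms]]] unfolding winding_sign_def by blast+

lemma winding_number_eq_0:
  "simple_polygon ps \<Longrightarrow> z \<notin> region ps \<Longrightarrow> winding_number (contour ps) z = 0"
  by (intro winding_number_zero_in_outside path_contour loop_contour)
    (auto simp: outer_region_eq simple_polygon_def)

text \<open>A point of \<open>M\<close> off the contours is inside exactly one quadrangle, whose
  sign and winding number multiply to 1. Outside \<open>M\<close> every term is 0.\<close>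

lemma signed_winding_numbers:
  assumes "\<And>q. q \<in> Q \<Longrightarrow> z \<notin> path_image (contour q)" "z \<notin> path_image (contour vs)"
  shows "(\<Sum>q\<in>Q. of_int (winding_sign q) * winding_number (contour q) z) = winding_number (contour vs) z"
proof (cases "z \<in> M")
  case True
  then obtain q where q: "q \<in> Q" "z \<in> region q" using M_eq by auto
  then have z: "z \<in> inner_region q" using assms(1) by (auto simp: region_def)
  have "winding_number (contour q') z = 0" if "q' \<in> Q - {q}" for q'
    using that inner_regions_disjoint[OF q(1) _ z] simple by (intro winding_number_eq_0) auto
  then have "(\<Sum>q\<in>Q. of_int (winding_sign q) * winding_number (contour q) z) =
      of_int (winding_sign q) * winding_number (contour q) z"
    using q(1) finite_Q by (subst sum.remove[of _ q]) auto
  also have "\<dots> = 1" using winding_sign[OF q(1)] z by auto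
  also have "\<dots> = winding_number (contour vs) z"
    using True assms(2) M_eq_region counterclockwise_vs by (auto simp: region_def)
  finally show ?thesis .
next
  case False
  then have "winding_number (contour q) z = 0" if "q \<in> Q" for q
    using that M_eq simple by (intro winding_number_eq_0) auto
  moreover have "winding_number (contour vs) z = 0"
    using False M_eq_region simple_vs by (intro winding_number_eq_0) auto
  ultimately show ?thesis by simp
qed

definition net_traversals :: "complex \<times> complex \<Rightarrow> complex" where
  "net_traversals p = (\<Sum>q\<in>Q. of_int (winding_sign q) * traversals q p) - traversals vs p"

text \<open>\<open>G\<close> is arbitrary because it is used twice: with winding numbers of
  segments, to learn about the coefficients, and with antisymmetric weights, to exploit what was
  learnt.\<close>

lemma sum_net_traversals:
  "(\<Sum>p\<in>oriented_edges. net_traversals p * case_prod G p) =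
     (\<Sum>q\<in>Q. of_int (winding_sign q) * cycle_sum G q) - cycle_sum G vs"
proof -
  have "cycle_sum G q = (\<Sum>p\<in>oriented_edges. traversals q p * case_prod G p)" if "q \<in> insert vs Q" for q
    using that side_eq_nth finite_oriented_edges
    by (intro cycle_sum_eq_sum_traversals) (auto simp: oriented_edges_def edges_def)
  then have "(\<Sum>q\<in>Q. of_int (winding_sign q) * cycle_sum G q) - cycle_sum G vs =
    (\<Sum>q\<in>Q. of_int (winding_sign q) * (\<Sum>p\<in>oriented_edges. traversals q p * case_prod G p)) -
      (\<Sum>p\<in>oriented_edges. traversals vs p * case_prod G p)" by simp
  also have "\<dots> = (\<Sum>p\<in>oriented_edges. net_traversals p * case_prod G p)"
    unfolding net_traversals_def left_diff_distrib sum_subtractf sum_distrib_left sum_distrib_right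
    by (subst sum.swap) (simp add: mult.assoc)
  finally show ?thesis by simp
qed

lemma net_traversals_symmetric:
  assumes "(a, b) \<in> oriented_edges"
  shows "net_traversals (a, b) = net_traversals (b, a)"
proof -
  obtain x where x: "x \<in> open_segment a b"
    "\<And>c d. (c, d) \<in> oriented_edges \<Longrightarrow> {c, d} \<noteq> {a, b} \<Longrightarrow> x \<notin> closed_segment c d"
    using generic_point_on_edge[OF assms] by metis
  show ?thesis
  proof (rule chain_coefficient_symmetric[OF finite_oriented_edges assms oriented_edges_swap[OF assms] x])
    fix z assume z: "\<And>c d. (c, d) \<in> oriented_edges \<Longrightarrow> z \<notin> closed_segment c d"
    have z': "z \<notin> path_image (contour ps)" if "ps \<in> insert vs Q" for ps
    proof -
      have "ps \<noteq> []" using that Q_nonempty vs_nonempty by auto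
      moreover have "(ps ! k, next_vertex ps k) \<in> oriented_edges" if "k < length ps" for k
        using \<open>ps \<in> insert vs Q\<close> side_eq_nth[OF that] by (auto simp: oriented_edges_def edges_def)
      ultimately show ?thesis using z by (auto simp: path_image_contour)
    qed
    let ?w = "\<lambda>c d. winding_number (linepath c d) z"
    have "cycle_sum ?w ps = winding_number (contour ps) z" if "ps \<in> insert vs Q" for ps
      using winding_number_contour[OF _ z'[OF that]] that Q_nonempty vs_nonempty
      by (auto simp: cycle_sum_def)
    then have "(\<Sum>q\<in>Q. of_int (winding_sign q) * cycle_sum ?w q) - cycle_sum ?w vs = 0"
      using signed_winding_numbers[of z] z' by simp
    then show "(\<Sum>(c, d)\<in>oriented_edges. net_traversals (c, d) * ?w c d) = 0"
      using sum_net_traversals[of ?w] by (simp add: case_prod_beta)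
  qed
qed

text \<open>A discrete Green formula. The argument runs over \<open>complex\<close>, where the
  coefficients live, and returns to \<open>int\<close> by injectivity of
  \<open>of_int\<close>.\<close>

theorem boundary_sum:
  fixes F :: "complex \<Rightarrow> complex \<Rightarrow> int"
  assumes "\<And>a b. F b a = - F a b"
  shows "(\<Sum>q\<in>Q. winding_sign q * cycle_sum F q) = cycle_sum F vs"
proof -
  let ?G = "\<lambda>a b. of_int (F a b) :: complex"
  have "(\<Sum>p\<in>oriented_edges. net_traversals p * case_prod ?G p) = 0"
  proof (rule sum_antisymmetric_eq_0)
    show "?G b a = - ?G a b" for a b using assms[of b a] by simp
  qed (fact oriented_edges_swap net_traversals_symmetric)+
  then have "(\<Sum>q\<in>Q. of_int (winding_sign q) * cycle_sum ?G q) = cycle_sum ?G vs"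
    by (simp add: sum_net_traversals)
  then have "of_int (\<Sum>q\<in>Q. winding_sign q * cycle_sum F q) = (of_int (cycle_sum F vs) :: complex)"
    by (simp add: cycle_sum_def)
  then show ?thesis by (simp only: of_int_eq_iff)
qed

text \<open>A side of \<open>vs\<close> that belongs to no quadrangle would have net multiplicity -1
  forwards and 0 backwards, against symmetry. The labelling hypothesis, which speaks of edges of
  \<open>Q\<close>, thereby reaches every side of \<open>vs\<close>.\<close>

lemma boundary_sides_subset_edges: "sides vs \<subseteq> edges Q"
proof
  fix e assume e: "e \<in> sides vs"
  then obtain k where k: "k < length vs" "e = {vs ! k, next_vertex vs k}" by (auto simp: sides_def)
  let ?a = "vs ! k" and ?b = "next_vertex vs k"
  let ?n = "length vs"
  have n: "?n \<ge> 3" "distinct vs" using simple_vs simple_polygon_distinct by (auto simp: simple_polygon_def)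
  have "(?a, ?b) \<in> oriented_edges" using e k by (auto simp: oriented_edges_def)
  have one: "traversals vs (?a, ?b) = 1"
  proof -
    have "traversals vs (?a, ?b) = (\<Sum>j<?n. if j = k then 1 else 0)"
      unfolding traversals_def cycle_sum_def using k n
      by (intro sum.cong) (auto simp: nth_eq_iff_index_eq)
    then show ?thesis using k by simp
  qed
  have zero: "traversals vs (?b, ?a) = 0"
  proof -
    have "(?b, ?a) \<noteq> (vs ! j, next_vertex vs j)" if "j < ?n" for j
      using simple_polygon_side_not_reversed[OF simple_vs k(1) that] by auto
    then show ?thesis unfolding traversals_def cycle_sum_def
      by (intro sum.neutral ballI if_not_P) (metis lessThan_iff)
  qed
  show "e \<in> edges Q"
  proof (rule ccontr)
    assume "e \<notin> edges Q"
    have "traversals q (u, v) = 0" if q: "q \<in> Q" and uv: "{u, v} = e" for q u v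
    proof -
      have "(u, v) \<noteq> (q ! j, next_vertex q j)" if "j < length q" for j
        using side_eq_nth[OF that] \<open>e \<notin> edges Q\<close> q uv unfolding edges_def by blast
      then show ?thesis
        unfolding traversals_def cycle_sum_def by (intro sum.neutral ballI if_not_P) (metis lessThan_iff)
    qed
    then have "traversals q (?a, ?b) = 0" "traversals q (?b, ?a) = 0" if "q \<in> Q" for q
      using that k(2) insert_commute[of ?a ?b "{}"] by metis+
    then have "net_traversals (?a, ?b) = - 1" "net_traversals (?b, ?a) = 0"
      using one zero by (simp_all add: net_traversals_def)
    then show False using net_traversals_symmetric[OF \<open>(?a, ?b) \<in> oriented_edges\<close>] by simp
  qed
qed

end

section \<open>Counting centrally labelled cells\<close>

text \<open>On the cycle of labels 1, 2, 3, 4 only the link from 1 to 2 has weight. A diagonal gets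
  the mean of the two ways round: from 1 to 3 it is 2 via label 2 and 0 via label 4, from 4 to 2 it
  is 2 via label 1 and 0 via label 3.\<close>

definition label_step :: "nat \<Rightarrow> nat \<Rightarrow> int" where
  "label_step i j =
     (if (i, j) = (1, 2) then 2 else if (i, j) = (2, 1) then - 2
      else if (i, j) \<in> {(1, 3), (4, 2)} then 1 else if (i, j) \<in> {(3, 1), (2, 4)} then - 1 else 0)"

lemma label_step_swap: "label_step j i = - label_step i j"
  by (simp add: label_step_def)

text \<open>Without central sides the labels make a closed walk of four steps, some perhaps
  stationary, on the 4-cycle. It sums to 0 unless it goes round once, and then it meets all four
  labels. The proof checks all 256 labellings.\<close>

lemma label_step_quadrangle:
  assumes "{i, j, k, l} \<subseteq> {1, 2, 3, 4}"
  shows "\<bar>label_step i j + label_step j k + label_step k l + label_step l i\<bar> \<le>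
    2 * of_bool ({i, j, k, l} = {1, 2, 3, 4}) +
    of_bool ({i, j} = {1, 3} \<or> {i, j} = {2, 4}) + of_bool ({j, k} = {1, 3} \<or> {j, k} = {2, 4}) +
    of_bool ({k, l} = {1, 3} \<or> {k, l} = {2, 4}) + of_bool ({l, i} = {1, 3} \<or> {l, i} = {2, 4})"
proof -
  \<comment> \<open>Set equality is unfolded into equations with numerals, which \<open>simp\<close>
    can decide in each case.\<close>
  have full: "{i, j, k, l} = {1, 2, 3, 4} \<longleftrightarrow>
      (i = 1 \<or> j = 1 \<or> k = 1 \<or> l = 1) \<and> (i = 2 \<or> j = 2 \<or> k = 2 \<or> l = 2) \<and>
      (i = 3 \<or> j = 3 \<or> k = 3 \<or> l = 3) \<and> (i = 4 \<or> j = 4 \<or> k = 4 \<or> l = 4)"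
    (is "?l \<longleftrightarrow> ?r")
  proof
    assume ?l
    then have "1 \<in> {i, j, k, l}" "2 \<in> {i, j, k, l}" "3 \<in> {i, j, k, l}" "4 \<in> {i, j, k, l}" by simp_all
    then show ?r by simp metis
  next
    assume ?r
    then have "{1, 2, 3, 4} \<subseteq> {i, j, k, l}" by simp metis
    with assms show ?l by (rule subset_antisym)
  qed
  have i: "i = 1 \<or> i = 2 \<or> i = 3 \<or> i = 4" and j: "j = 1 \<or> j = 2 \<or> j = 3 \<or> j = 4"
    and k: "k = 1 \<or> k = 2 \<or> k = 3 \<or> k = 4" and l: "l = 1 \<or> l = 2 \<or> l = 3 \<or> l = 4"
    using assms by auto
  show ?thesis unfolding full label_step_def doubleton_eq_iff
    using i by (elim disjE; use j in \<open>elim disjE\<close>; use k in \<open>elim disjE\<close>; use l in \<open>elim disjE\<close>; simp)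
qed

lemma cycle_sum_label_step_quadrangle:
  assumes "length q = 4" "L ` set q \<subseteq> {1, 2, 3, 4}"
  shows "\<bar>cycle_sum (\<lambda>u v. label_step (L u) (L v)) q\<bar> \<le>
    2 * of_bool (centrally_labelled L (Face q)) +
    (\<Sum>k<length q. of_bool (central_edge L {q ! k, next_vertex q k}))"
proof -
  obtain a b c d where q: "q = [a, b, c, d]"
    using assms(1) by (auto simp: length_Suc_conv numeral_eq_Suc)
  have four: "{..<4::nat} = {0, 1, 2, 3}" by auto
  show ?thesis
    using label_step_quadrangle[of "L a" "L b" "L c" "L d"] assms(2)
    by (simp add: q cycle_sum_def four next_vertex_def central_edge_def)
qed

lemma sum_eq_diff_card:
  assumes "finite A"
  shows "(\<Sum>k\<in>A. 2 * of_bool (P k) - 2 * of_bool (R k)) =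
     2 * (int (card {k \<in> A. P k}) - int (card {k \<in> A. R k}))"
  using assms by (simp add: sum_subtractf flip: sum_distrib_left) (simp add: Int_def algebra_simps)

text \<open>With no central side the half steps do not occur; only passages between 1 and 2 remain,
  each with weight 2 or -2.\<close>

lemma cycle_sum_label_step_boundary:
  assumes "L ` set vs \<subseteq> {1, 2, 3, 4}" "\<And>e. e \<in> sides vs \<Longrightarrow> \<not> central_edge L e"
  shows "cycle_sum (\<lambda>u v. label_step (L u) (L v)) vs = 2 * deg L vs"
proof -
  have step: "label_step (L (vs ! k)) (L (next_vertex vs k)) =
     2 * of_bool (L (vs ! k) = 1 \<and> L (next_vertex vs k) = 2) -
     2 * of_bool (L (vs ! k) = 2 \<and> L (next_vertex vs k) = 1)" if "k < length vs" for k
    using assms(2)[OF side_eq_nth[OF that]]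
    by (auto simp: label_step_def central_edge_def doubleton_eq_iff)
  have "cycle_sum (\<lambda>u v. label_step (L u) (L v)) vs =
     (\<Sum>k\<in>{..<length vs}. 2 * of_bool (L (vs ! k) = 1 \<and> L (next_vertex vs k) = 2) -
     2 * of_bool (L (vs ! k) = 2 \<and> L (next_vertex vs k) = 1))"
    unfolding cycle_sum_def using step by (intro sum.cong) auto
  then show ?thesis by (subst (asm) sum_eq_diff_card) (simp_all add: deg_def)
qed

section \<open>Double counting over faces and central edges\<close>

context bounded_quadrangulation
begin

lemma finite_edges: "finite (edges Q)"
proof -
  have "finite (sides q)" for q
    using finite_image_set[of "\<lambda>k. k < length q"] by (simp add: sides_def)
  then show ?thesis using finite_Q by (simp add: edges_def)
qed

text \<open>Replacing positions in \<open>q\<close> by incidences with a fixed set of edges prepares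
  the interchange of sums. It is exact because different positions give different sides, even as
  unordered pairs.\<close>

lemma sum_central_sides:
  assumes "q \<in> Q"
  shows "(\<Sum>k<length q. of_bool (central_edge L {q ! k, next_vertex q k})) =
    (\<Sum>e\<in>{e \<in> edges Q. central_edge L e}. of_bool (e \<in> sides q) :: int)"
proof -
  let ?s = "\<lambda>k. {q ! k, next_vertex q k}"
  have sides: "sides q = ?s ` {..<length q}" by (auto simp: sides_def)
  then have "(\<Sum>k<length q. of_bool (central_edge L (?s k)) :: int) = (\<Sum>e\<in>sides q. of_bool (central_edge L e))"
    unfolding sides by (subst sum.reindex[OF inj_on_sides[OF simple[OF assms]]]) (simp only: o_def)
  also have "\<dots> = (\<Sum>e\<in>edges Q. of_bool (e \<in> sides q \<and> central_edge L e))"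
    using assms finite_edges by (intro sum.mono_neutral_cong_left) (auto simp: edges_def)
  also have "\<dots> = (\<Sum>e\<in>{e \<in> edges Q. central_edge L e}. of_bool (e \<in> sides q))"
    using finite_edges by (intro sum.mono_neutral_cong_right) auto
  finally show ?thesis .
qed

lemma sum_faces_at_edge:
  assumes "e \<in> edges Q"
  shows "(\<Sum>q\<in>Q. of_bool (e \<in> sides q) :: int) \<le> 2"
proof -
  obtain a b where e: "e = {a, b}" using assms by (auto simp: edges_def sides_def)
  then have "a \<noteq> b" using assms oriented_edges_distinct[of a b] by (simp add: oriented_edges_def)
  have "(\<Sum>q\<in>Q. of_bool (e \<in> sides q) :: int) = int (card {q \<in> Q. e \<in> sides q})"
    using finite_Q by (simp add: Int_def)
  then show ?thesis using card_faces_at_edge[OF \<open>a \<noteq> b\<close>] e by simp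
qed

lemma abs_cycle_sum_label_step_vs:
  assumes "L ` vertices Q \<subseteq> {1, 2, 3, 4}"
  shows "\<bar>cycle_sum (\<lambda>u v. label_step (L u) (L v)) vs\<bar> \<le>
     2 * int (card {c \<in> cells Q. centrally_labelled L c})"
proof -
  let ?F = "\<lambda>u v. label_step (L u) (L v)"
  let ?A = "{q \<in> Q. centrally_labelled L (Face q)}" and ?C = "{e \<in> edges Q. central_edge L e}"
  have face: "\<bar>winding_sign q * cycle_sum ?F q\<bar> \<le> 2 * of_bool (centrally_labelled L (Face q)) +
      (\<Sum>e\<in>?C. of_bool (e \<in> sides q))" if "q \<in> Q" for q
  proof -
    have "L ` set q \<subseteq> {1, 2, 3, 4}" using assms that unfolding vertices_def by blast
    from cycle_sum_label_step_quadrangle[OF length_Q[OF that] this]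
    have "\<bar>cycle_sum ?F q\<bar> \<le> 2 * of_bool (centrally_labelled L (Face q)) +
      (\<Sum>e\<in>?C. of_bool (e \<in> sides q))"
      unfolding sum_central_sides[OF that] .
    moreover have "\<bar>winding_sign q * cycle_sum ?F q\<bar> = \<bar>cycle_sum ?F q\<bar>"
      using winding_sign(1)[OF that] by auto
    ultimately show ?thesis by (simp only:)
  qed
  have "cycle_sum ?F vs = (\<Sum>q\<in>Q. winding_sign q * cycle_sum ?F q)"
    by (rule boundary_sum[symmetric]) (rule label_step_swap)
  then have "\<bar>cycle_sum ?F vs\<bar> \<le> (\<Sum>q\<in>Q. \<bar>winding_sign q * cycle_sum ?F q\<bar>)"
    by simp
  also have "\<dots> \<le> (\<Sum>q\<in>Q. 2 * of_bool (centrally_labelled L (Face q)) + (\<Sum>e\<in>?C. of_bool (e \<in> sides q)))"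
    using face by (rule sum_mono)
  also have "\<dots> = 2 * int (card ?A) + (\<Sum>e\<in>?C. \<Sum>q\<in>Q. of_bool (e \<in> sides q))"
    using finite_Q by (subst sum.swap) (simp add: sum.distrib Int_def flip: sum_distrib_left)
  also have "(\<Sum>e\<in>?C. \<Sum>q\<in>Q. of_bool (e \<in> sides q) :: int) \<le> (\<Sum>e\<in>?C. 2)"
    by (rule sum_mono) (simp only: sum_faces_at_edge mem_Collect_eq)
  \<comment> \<open>Cells made by \<open>Face\<close> and by \<open>Edge\<close> are different, so
    the two counts add up.\<close>
  also have "2 * int (card ?A) + (\<Sum>e\<in>?C. 2) = 2 * int (card (Face ` ?A \<union> Edge ` ?C))"
    using finite_Q finite_edges by (subst card_Un_disjoint) (auto simp: card_image inj_on_def)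
  also have "\<dots> \<le> 2 * int (card {c \<in> cells Q. centrally_labelled L c})"
  proof -
    have "finite (cells Q)"
      using finite_Q finite_edges finite_vertices by (simp add: cells_def)
    then have "card (Face ` ?A \<union> Edge ` ?C) \<le> card {c \<in> cells Q. centrally_labelled L c}"
      by (intro card_mono) (auto simp: cells_def)
    then show ?thesis by simp
  qed
  finally show ?thesis by simp
qed

end

theorem theoremC:
  fixes M :: "complex set" and Q :: "complex list set"
    and vs :: "complex list" and L :: "complex \<Rightarrow> nat"
  assumes "polygon M"
    and "quadrangulation Q M"
    and "boundary_contour Q M vs"
    and "L ` vertices Q \<subseteq> {1, 2, 3, 4}"
    and "\<forall>e \<in> edges Q. convex hull e \<subseteq> path_image (contour vs) \<longrightarrow> \<not> central_edge L e"
  shows "\<bar>deg L vs\<bar> \<le> int (card {c \<in> cells Q. centrally_labelled L c})"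
proof -
  interpret bounded_quadrangulation Q M vs using assms(1-3) by unfold_locales
  have "\<not> central_edge L e" if e: "e \<in> sides vs" for e
  proof -
    obtain a b where ab: "e = {a, b}" using e by (auto simp: sides_def)
    have "e \<in> edges Q" using e boundary_sides_subset_edges by blast
    moreover have "convex hull e \<subseteq> path_image (contour vs)"
      using side_subset_contour[of a b vs] e ab by (simp add: segment_convex_hull)
    ultimately show ?thesis using assms(5) by blast
  qed
  moreover have "L ` set vs \<subseteq> {1, 2, 3, 4}" using assms(4) set_vs by blast
  ultimately have "cycle_sum (\<lambda>u v. label_step (L u) (L v)) vs = 2 * deg L vs"
    by (intro cycle_sum_label_step_boundary)
  then show ?thesis using abs_cycle_sum_label_step_vs[OF assms(4)] by simp
qed

end
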